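(* Let $H$ be a finite simple graph with maximum degree $\Delta(H)\geq 6$ and clique number $\omega(H)\leq \Delta(H)-1$. Let $k\geq 1$ and let $p_1\geq p_2\geq\cdots\geq p_k\geq 2$ be integers with $\sum_{i=1}^k p_i=\Delta(H)-1+k$. If $p_1\geq 4$, then there exists a partition of $V(H)$ into sets $V_1,V_2,\ldots,V_k$ such that for each $1\leq i\leq k$, the induced subgraph $H[V_i]$ contains no copy of $K_{p_i}$ (as a subgraph).
   Context: All graphs are finite, simple and undirected. $K_p$ denotes the complete graph on $p$ vertices. $\omega(H)$ is the largest order of a complete subgraph of $H$. For $W\subseteq V(H)$, $H[W]$ is the subgraph induced by $W$. A graph is $K_p$-free if it contains no subgraph isomorphic to $K_p$. Parts of a partition are allowed to be empty. *)

theory Defs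
  imports "Graph_Theory.Graph_Theory" "HOL-Library.Disjoint_Sets"
begin

text \<open>
  A finite simple undirected graph is a \<^prop>\<open>graph G\<close>: a finite symmetric digraph without loops
  and parallel arcs. Each undirected edge is a pair of opposite arcs, so the degree of a vertex is
  its out-degree (equivalently its in-degree).
\<close>

text \<open>The element 0 is inserted only to give the graph without vertices maximum degree 0.\<close>

definition max_degree :: "('a, 'b) pre_digraph \<Rightarrow> nat" where
  "max_degree G = Max (insert 0 (out_degree G ` verts G))"

text \<open>
  The set below is bounded by the number of vertices and contains 0, so for a finite graph its
  maximum is well defined.
\<close>

definition clique_number :: "('a, 'b) pre_digraph \<Rightarrow> nat" where
  "clique_number G = Max {n. \<exists>K. subgraph K G \<and> K\<^bsub>n\<^esub> K}"

definition clique_free :: "nat \<Rightarrow> ('a, 'b) pre_digraph \<Rightarrow> bool" where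
  "clique_free n G \<longleftrightarrow> \<not> (\<exists>K. subgraph K G \<and> K\<^bsub>n\<^esub> K)"

end

theory Submission
  imports Defs
begin

text \<open>
  Put \<open>r = \<Delta> - 1 \<ge> 5\<close>. It suffices to remove \<open>r - 3\<close> independent sets so that the rest
  contains no 4-clique: merging the rest with \<open>p\<^sub>1 - 4\<close> of these sets and grouping the others gives
  all the required parts.

  The sets are removed one at a time. In a graph of maximum degree \<open>r + 1\<close> without
  \<open>(r + 1)\<close>-cliques and with \<open>r \<ge> 5\<close>, meeting \<open>r\<close>-cliques form clusters whose cores are large
  compared with the number of neighbours outside them, so by Haxell's argument there is an
  independent transversal of the cores. It hits all \<open>r\<close>-cliques, and a maximal such set lowers both
  the degree and the clique bound by one.

  At \<open>r = 4\<close> this fails for odd cycles with each vertex blown up to an edge. Therefore the last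
  set removed at \<open>r = 5\<close> is chosen of maximum size among those that also hit a maximal disjoint family
  of such subgraphs, and then none is left. The meeting 4-cliques without a common core then form
  paths, which can be contracted to reduce to independent transversals again.
\<close>

text \<open>Two meeting \<open>r\<close>-cliques share a vertex of degree at most
  \<open>r + 1\<close>, so their union has at most \<open>r + 2\<close> vertices and they overlap in
  at least \<open>r - 2\<close>. Two disjoint overlaps fit into one clique only if
  \<open>2 * (r - 2) \<le> r\<close>; hence meeting is transitive for \<open>r \<ge> 5\<close>, and
  paths of cliques can arise at \<open>r = 4\<close>. If a cluster has union \<open>U\<close>, a
  core vertex has at most \<open>d = r + 2 - card U\<close> neighbours outside \<open>U\<close>, and
  the core has at least \<open>d + (r - 2)\<close> vertices. Since always \<open>d \<le> 2\<close>,
  the transversal argument asks only for \<open>d + 2\<close>. The surplus \<open>r - 4\<close> is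
  one vertex at \<open>r = 5\<close>, which is what a core may lose when it is cut down to a
  blown-up cycle; this is why these can be hit by the same set. Maximum size is needed, and not just
  maximality under inclusion, because a surviving blown-up cycle is refuted by trading one chosen
  vertex for two. The bound on \<open>p 1\<close> comes from the remainder: part \<open>i\<close>
  can absorb \<open>p i - 1\<close> independent sets, these numbers add up to \<open>r\<close>, and
  a remainder without 4-cliques counts as three such sets.\<close>

locale sym_irrefl =
  fixes adj :: "'a \<Rightarrow> 'a \<Rightarrow> bool"
  assumes adj_sym: "adj x y \<Longrightarrow> adj y x"
    and adj_irrefl: "\<not> adj x x"
begin

definition nbh :: "'a set \<Rightarrow> 'a \<Rightarrow> 'a set" where
  "nbh X v = {u \<in> X. adj v u}"

definition clique :: "'a set \<Rightarrow> bool" where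
  "clique K \<longleftrightarrow> (\<forall>x\<in>K. \<forall>y\<in>K. x \<noteq> y \<longrightarrow> adj x y)"

definition indep :: "'a set \<Rightarrow> bool" where
  "indep I \<longleftrightarrow> (\<forall>x\<in>I. \<forall>y\<in>I. \<not> adj x y)"

definition cliques :: "nat \<Rightarrow> 'a set \<Rightarrow> 'a set set" where
  "cliques r X = {K. K \<subseteq> X \<and> card K = r \<and> clique K}"

lemma nbh_mono: "X \<subseteq> Y \<Longrightarrow> nbh X v \<subseteq> nbh Y v"
  by (auto simp: nbh_def)

lemma finite_nbh: "finite X \<Longrightarrow> finite (nbh X v)"
  by (simp add: nbh_def)

lemma card_nbh_mono: "X \<subseteq> Y \<Longrightarrow> finite Y \<Longrightarrow> card (nbh X v) \<le> card (nbh Y v)"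
  by (meson card_mono finite_nbh nbh_mono)

subsection \<open>Independent transversals\<close>

text \<open>\<open>R\<close> is the part not yet represented. At a stage with explored parts \<open>\<S>\<close>, the values \<open>\<tau>\<close> on
  \<open>\<S>\<close> are frozen and the representatives outside \<open>\<S>\<close> avoid the neighbours of \<open>W\<close>. By counting,
  some \<open>w\<close> in an explored part has no neighbour among \<open>W\<close> and \<open>\<tau>\<close>. If the number of
  representatives adjacent to \<open>w\<close> is minimal but positive, explore their parts too; the vertex found
  at the later stage could replace one of them, so it must lie in a part of \<open>\<S>\<close>.\<close>

lemma transversal_step:
  fixes \<P> :: "'a set set" and d :: "'a set \<Rightarrow> nat"
  assumes fin: "finite \<P>" "\<And>P. P \<in> \<P> \<Longrightarrow> finite P"
    and disj: "pairwise disjnt \<P>"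
    and D: "D > 0" "\<And>P. P \<in> \<P> \<Longrightarrow> d P \<le> D" "\<And>P. P \<in> \<P> \<Longrightarrow> D + d P \<le> card P"
    and deg: "\<And>P v. P \<in> \<P> \<Longrightarrow> v \<in> P \<Longrightarrow> card (nbh (\<Union>\<P> - P) v) \<le> d P"
    and R: "R \<in> \<P>"
    and adm_def: "\<And>\<S> W \<tau> T. adm \<S> W \<tau> T \<longleftrightarrow> (\<forall>P\<in>\<P>-{R}. T P \<in> P) \<and>
      (\<forall>P\<in>\<P>-{R}. \<forall>Q\<in>\<P>-{R}. \<not> adj (T P) (T Q)) \<and>
      (\<forall>P\<in>\<S>-{R}. T P = \<tau> P) \<and> (\<forall>w\<in>W. \<forall>P\<in>\<P>-\<S>. \<not> adj w (T P))"
  assumes "\<S> \<subseteq> \<P>" "R \<in> \<S>" "W \<subseteq> \<Union>\<S>" "finite W" "card W < card \<S>" "\<exists>T. adm \<S> W \<tau> T"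
  shows "\<exists>T P w. adm \<S> W \<tau> T \<and> P \<in> \<S> \<and> w \<in> P \<and> (\<forall>Q\<in>\<P>-{R}-{P}. \<not> adj w (T Q)) \<and>
    (\<forall>x\<in>W. x \<notin> P \<longrightarrow> \<not> adj x w)"
  using assms(10-)
proof (induction "card (\<P> - \<S>)" arbitrary: \<S> W \<tau> rule: less_induct)
  case less
  note \<S> = \<open>\<S> \<subseteq> \<P>\<close> and RS = \<open>R \<in> \<S>\<close> and W = \<open>W \<subseteq> \<Union>\<S>\<close> \<open>finite W\<close> \<open>card W < card \<S>\<close>
  have finS: "finite \<S>" using \<S> fin(1) finite_subset by blast
  have uniq: "P = Q" if "P \<in> \<P>" "Q \<in> \<P>" "x \<in> P" "x \<in> Q" for P Q x
    using disj that by (auto simp: pairwise_def disjnt_def)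
  obtain T0 where T0: "adm \<S> W \<tau> T0" using less.prems by blast
  have \<tau>: "\<tau> P \<in> P" if "P \<in> \<S> - {R}" for P
    using T0 that \<S> unfolding adm_def by (metis DiffD1 DiffD2 DiffI subsetD)
  have finU: "finite (\<Union>\<P>)" using fin by blast
  define prt where "prt w = (SOME P. P \<in> \<S> \<and> w \<in> P)" for w
  have prt: "prt w \<in> \<S>" "w \<in> prt w" if "w \<in> W" for w
  proof -
    have "\<exists>P. P \<in> \<S> \<and> w \<in> P" using that W(1) by blast
    from someI_ex[OF this] show "prt w \<in> \<S>" "w \<in> prt w" by (auto simp: prt_def)
  qed
  define B1 where "B1 = (\<Union>w\<in>W. nbh (\<Union>\<P> - prt w) w)"
  define B2 where "B2 = (\<Union>Q\<in>\<S>-{R}. nbh (\<Union>\<P> - Q) (\<tau> Q))"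
  have "card B1 \<le> (\<Sum>w\<in>W. card (nbh (\<Union>\<P> - prt w) w))"
    unfolding B1_def by (rule card_UN_le[OF W(2)])
  also have "\<dots> \<le> (\<Sum>w\<in>W. D)"
  proof (rule sum_mono)
    fix w assume "w \<in> W"
    then show "card (nbh (\<Union>\<P> - prt w) w) \<le> D"
      using deg[of "prt w" w] D(2)[of "prt w"] prt[of w] \<S> by force
  qed
  also have "\<dots> \<le> (\<Sum>Q\<in>\<S>-{R}. D)"
  proof -
    have "card W \<le> card (\<S> - {R})" using W(3) RS finS by (simp add: card_Diff_singleton)
    then show ?thesis by (simp only: sum_constant) (simp add: mult_le_mono1)
  qed
  finally have b1: "card B1 \<le> (\<Sum>Q\<in>\<S>-{R}. D)" .
  have "card B2 \<le> (\<Sum>Q\<in>\<S>-{R}. card (nbh (\<Union>\<P> - Q) (\<tau> Q)))"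
    unfolding B2_def by (rule card_UN_le) (use finS in auto)
  also have "\<dots> \<le> (\<Sum>Q\<in>\<S>-{R}. d Q)"
    by (rule sum_mono) (use deg \<tau> \<S> in auto)
  finally have b2: "card B2 \<le> (\<Sum>Q\<in>\<S>-{R}. d Q)" .
  have "card (B1 \<union> B2) \<le> (\<Sum>Q\<in>\<S>-{R}. D) + (\<Sum>Q\<in>\<S>-{R}. d Q)"
    using card_Un_le[of B1 B2] b1 b2 by linarith
  also have "\<dots> = (\<Sum>Q\<in>\<S>-{R}. D + d Q)" by (simp only: sum.distrib)
  \<comment> \<open>\<open>R\<close> has no frozen value and \<open>W\<close> is smaller than
    \<open>\<S>\<close>, so \<open>R\<close> is not charged on the left; strictness comes from
    \<open>D > 0\<close>.\<close>
  also have "\<dots> < (\<Sum>Q\<in>\<S>. D + d Q)"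
    using sum.remove[OF finS RS, of "\<lambda>Q. D + d Q"] D(1) by linarith
  also have "\<dots> \<le> (\<Sum>Q\<in>\<S>. card Q)" by (rule sum_mono) (use D(3) \<S> in blast)
  also have "\<dots> = card (\<Union>\<S>)"
    using card_Union_disjoint[of \<S>] pairwise_subset[OF disj \<S>] \<S> fin(2) by (simp add: subset_iff)
  finally have lt: "card (B1 \<union> B2) < card (\<Union>\<S>)" .
  have "finite (B1 \<union> B2)" unfolding B1_def B2_def
    using W(2) finS finU by (auto intro!: finite_nbh)
  then have "\<not> \<Union>\<S> \<subseteq> B1 \<union> B2" using lt by (meson card_mono leD)
  then obtain w P where w: "w \<in> P" "P \<in> \<S>" "w \<notin> B1" "w \<notin> B2" by blast
  have wU: "w \<in> \<Union>\<P>" using w \<S> by blast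
  have wW: "\<not> adj x w" if "x \<in> W" "x \<notin> P" for x
  proof
    assume "adj x w"
    have "w \<notin> prt x" using uniq[of "prt x" P w] prt[OF that(1)] w \<S> that(2) by blast
    then show False using w(3) \<open>adj x w\<close> that wU by (auto simp: B1_def nbh_def)
  qed
  have w\<tau>: "\<not> adj w (\<tau> Q)" if "Q \<in> \<S> - {R}" "Q \<noteq> P" for Q
  proof
    assume "adj w (\<tau> Q)"
    have "w \<notin> Q" using uniq[of Q P w] that w \<S> by blast
    then show False using w(4) adj_sym[OF \<open>adj w (\<tau> Q)\<close>] that wU by (auto simp: B2_def nbh_def)
  qed
  define Bl where "Bl T = {Q \<in> \<P> - {R} - {P}. adj w (T Q)}" for T
  obtain T where T: "adm \<S> W \<tau> T" and Tmin: "\<And>T'. adm \<S> W \<tau> T' \<Longrightarrow> card (Bl T) \<le> card (Bl T')"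
    using ex_has_least_nat[of "adm \<S> W \<tau>" T0 "\<lambda>T. card (Bl T)"] T0 by blast
  have finB: "finite (Bl T')" for T' using fin(1) by (simp add: Bl_def)
  show ?case
  proof (cases "Bl T = {}")
    case True
    then have "\<not> adj w (T Q)" if "Q \<in> \<P>-{R}-{P}" for Q using that unfolding Bl_def by blast
    then have "\<forall>Q\<in>\<P>-{R}-{P}. \<not> adj w (T Q)" ..
    moreover have "\<forall>x\<in>W. x \<notin> P \<longrightarrow> \<not> adj x w" using wW by (intro ballI impI)
    ultimately have "adm \<S> W \<tau> T \<and> P \<in> \<S> \<and> w \<in> P \<and> (\<forall>Q\<in>\<P>-{R}-{P}. \<not> adj w (T Q)) \<and>
      (\<forall>x\<in>W. x \<notin> P \<longrightarrow> \<not> adj x w)"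
      by (intro conjI T w(1,2))
    then show ?thesis
      by - (rule exI[where x = T], rule exI[where x = P], rule exI[where x = w], assumption)
  next
    case False
    have BS: "Bl T \<inter> \<S> = {}"
    proof (rule ccontr)
      assume "Bl T \<inter> \<S> \<noteq> {}"
      then obtain Q where Q: "Q \<in> \<S> - {R}" "Q \<noteq> P" "adj w (T Q)" by (auto simp: Bl_def)
      moreover have "T Q = \<tau> Q" using T Q(1) unfolding adm_def by meson
      ultimately show False using w\<tau>[of Q] by simp
    qed
    have BP: "Bl T \<subseteq> \<P>" by (auto simp: Bl_def)
    define \<S>' where "\<S>' = \<S> \<union> Bl T"
    define W' where "W' = insert w W"
    have "\<S> \<subset> \<S>'" using BS False unfolding \<S>'_def by blast
    moreover have "finite \<S>'" using finS finB unfolding \<S>'_def by simp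
    ultimately have "card \<S> < card \<S>'" by (simp add: psubset_card_mono)
    moreover have "card W' \<le> Suc (card W)" unfolding W'_def by (simp add: card_insert_le_m1 W(2) card_insert_if)
    ultimately have c: "card W' < card \<S>'" using W(3) by linarith
    have "\<P> - \<S>' \<subset> \<P> - \<S>" using False BS BP unfolding \<S>'_def by blast
    then have m: "card (\<P> - \<S>') < card (\<P> - \<S>)" using fin(1) by (simp add: psubset_card_mono)
    have wT: "\<not> adj w (T Q)" if "Q \<in> \<P> - \<S>'" for Q
      using that RS w(2) by (auto simp: \<S>'_def Bl_def)
    \<comment> \<open>Freezing \<open>T\<close> on the blockers lets \<open>w\<close> join
      \<open>W\<close>: every representative still unexplored is non-adjacent to
      \<open>w\<close>.\<close>
    have adm': "adm \<S>' W' T T"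
    proof -
      have "\<not> adj x (T Q)" if "x \<in> W'" "Q \<in> \<P> - \<S>'" for x Q
        using that wT[of Q] T unfolding adm_def W'_def \<S>'_def by (metis DiffD1 DiffD2 DiffI UnI1 insertE)
      moreover have "\<forall>P\<in>\<P>-{R}. T P \<in> P" "\<forall>P\<in>\<P>-{R}. \<forall>Q\<in>\<P>-{R}. \<not> adj (T P) (T Q)"
        using T unfolding adm_def by meson+
      ultimately show ?thesis unfolding adm_def by simp
    qed
    have "\<exists>T' P w'. adm \<S>' W' T T' \<and> P \<in> \<S>' \<and> w' \<in> P \<and>
      (\<forall>Q\<in>\<P>-{R}-{P}. \<not> adj w' (T' Q)) \<and> (\<forall>x\<in>W'. x \<notin> P \<longrightarrow> \<not> adj x w')"
    proof (rule less.hyps[OF m])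
      show "\<S>' \<subseteq> \<P>" "R \<in> \<S>'" using \<S> BP RS by (auto simp: \<S>'_def)
      show "W' \<subseteq> \<Union>\<S>'" using W(1) w(1,2) by (auto simp: \<S>'_def W'_def)
      show "finite W'" using W(2) by (simp add: W'_def)
      show "\<exists>Ta. adm \<S>' W' T Ta" using adm' by blast
    qed (rule c)
    then obtain T' P' w' where H: "adm \<S>' W' T T' \<and> P' \<in> \<S>' \<and> w' \<in> P' \<and>
      (\<forall>Q\<in>\<P>-{R}-{P'}. \<not> adj w' (T' Q)) \<and> (\<forall>x\<in>W'. x \<notin> P' \<longrightarrow> \<not> adj x w')"
      by (elim exE) (rule that)
    have T': "adm \<S>' W' T T'" "P' \<in> \<S>'" "w' \<in> P'"
      "\<And>Q. Q\<in>\<P>-{R}-{P'} \<Longrightarrow> \<not> adj w' (T' Q)" "\<And>x. x\<in>W' \<Longrightarrow> x \<notin> P' \<Longrightarrow> \<not> adj x w'"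
      using H by meson+
    have Tag: "T P = \<tau> P" if "P \<in> \<S> - {R}" for P
      using T that unfolding adm_def by meson
    have Tna: "\<not> adj x (T P)" if "x \<in> W" "P \<in> \<P> - \<S>" for x P
      using T that unfolding adm_def by meson
    have T'in: "T' P \<in> P" if "P \<in> \<P> - {R}" for P
      using T'(1) that unfolding adm_def by meson
    have T'ind: "\<not> adj (T' P) (T' Q)" if "P \<in> \<P> - {R}" "Q \<in> \<P> - {R}" for P Q
      using T'(1) that unfolding adm_def by meson
    have T'ag: "T' P = T P" if "P \<in> \<S>' - {R}" for P
      using T'(1) that unfolding adm_def by meson
    have T'na: "\<not> adj x (T' P)" if "x \<in> W'" "P \<in> \<P> - \<S>'" for x P
      using T'(1) that unfolding adm_def by meson
    have T'\<tau>: "T' P = \<tau> P" if "P \<in> \<S> - {R}" for P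
      using T'ag[of P] Tag[of P] that unfolding \<S>'_def by simp
    have T'naS: "\<not> adj x (T' Q)" if "x \<in> W" "Q \<in> \<P> - \<S>" for x Q
    proof (cases "Q \<in> \<S>'")
      case True
      then have "T' Q = T Q" using T'ag[of Q] that RS by blast
      then show ?thesis using Tna[OF that] by simp
    next
      case False
      then show ?thesis using T'na[of x Q] that by (simp add: W'_def)
    qed
    \<comment> \<open>\<open>T'\<close> still satisfies the conditions of the earlier stage, so it
      either answers for that stage directly or can be modified in one part to compete with
      \<open>T\<close>.\<close>
    have T'old: "adm \<S> W \<tau> T'"
      unfolding adm_def using T'in T'ind T'\<tau> T'naS by (intro conjI ballI)
    show ?thesis
    proof (cases "P' \<in> \<S>")
      case True
      have "\<forall>x\<in>W. x \<notin> P' \<longrightarrow> \<not> adj x w'" using T'(5) unfolding W'_def by blast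
      moreover have "\<forall>Q\<in>\<P>-{R}-{P'}. \<not> adj w' (T' Q)" using T'(4) ..
      ultimately have "adm \<S> W \<tau> T' \<and> P' \<in> \<S> \<and> w' \<in> P' \<and> (\<forall>Q\<in>\<P>-{R}-{P'}. \<not> adj w' (T' Q)) \<and>
        (\<forall>x\<in>W. x \<notin> P' \<longrightarrow> \<not> adj x w')"
        by (intro conjI T'old True T'(3))
      then show ?thesis
        by - (rule exI[where x = T'], rule exI[where x = P'], rule exI[where x = w'], assumption)
    next
      case False
      then have PB: "P' \<in> Bl T" using T'(2) by (simp add: \<S>'_def)
      have PP: "P' \<in> \<P>" "P' \<noteq> R" "P' \<noteq> P" using PB by (auto simp: Bl_def)
      have nW: "\<not> adj x w'" if "x \<in> W'" for x
      proof -
        have "\<exists>Q\<in>\<S>. x \<in> Q" using that W(1) w(1,2) unfolding W'_def by blast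
        then have "x \<notin> P'" using uniq[of _ P' x] False PP(1) \<S> by blast
        then show ?thesis using T'(5) that by blast
      qed
      define T'' where "T'' = T'(P' := w')"
      have "adm \<S> W \<tau> T''"
        unfolding adm_def
      proof (intro conjI ballI)
        fix Q assume "Q \<in> \<P> - {R}"
        then show "T'' Q \<in> Q" using T'in[of Q] T'(3) by (simp add: T''_def)
      next
        fix Q Q' assume "Q \<in> \<P> - {R}" "Q' \<in> \<P> - {R}"
        then show "\<not> adj (T'' Q) (T'' Q')"
          using T'ind[of Q Q'] T'(4)[of Q] T'(4)[of Q'] adj_sym[of "T' Q" w'] adj_irrefl[of w']
          by (auto simp: T''_def)
      next
        fix Q assume "Q \<in> \<S> - {R}"
        then show "T'' Q = \<tau> Q" using T'\<tau>[of Q] False by (auto simp: T''_def)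
      next
        fix x Q assume "x \<in> W" "Q \<in> \<P> - \<S>"
        then show "\<not> adj x (T'' Q)" using T'naS[of x Q] nW[of x] by (auto simp: T''_def W'_def)
      qed
      \<comment> \<open>No blocker is gained: on \<open>\<S>\<close> the values are those of
        \<open>\<tau>\<close>, which avoid \<open>w\<close> outside \<open>P\<close>, and beyond
        \<open>\<S>'\<close> they avoid \<open>w\<close> because \<open>w \<in> W'\<close>. The
        blocker \<open>P'\<close> is lost, since \<open>w'\<close> is not adjacent to
        \<open>w\<close>.\<close>
      moreover have "Bl T'' \<subset> Bl T"
      proof -
        have "Q \<in> Bl T" if "Q \<in> Bl T''" for Q
        proof (rule ccontr)
          assume n: "Q \<notin> Bl T"
          have Q: "Q \<in> \<P>" "Q \<noteq> R" "Q \<noteq> P" "adj w (T'' Q)" using that by (auto simp: Bl_def)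
          have "Q \<noteq> P'" using n PB by blast
          then have a: "adj w (T' Q)" using Q by (simp add: T''_def)
          then have "Q \<in> \<S>'" using T'na[of w Q] Q by (auto simp: W'_def)
          then have "Q \<in> \<S>" using n by (simp add: \<S>'_def)
          then show False using a T'\<tau>[of Q] w\<tau>[of Q] Q by simp
        qed
        moreover have "P' \<notin> Bl T''" using nW[of w] by (auto simp: Bl_def T''_def W'_def)
        ultimately show ?thesis using PB by blast
      qed
      ultimately show ?thesis using Tmin[of T''] psubset_card_mono[OF finB[of T], of "Bl T''"] by simp
    qed
  qed
qed

text \<open>The summand 2 is the uniform bound \<open>D\<close> of the counting step, and
  \<open>d\<close> is the bound of this part alone. Thus sizes 2, 3, 4 suffice for 0, 1, 2 outside
  neighbours. \<open>E\<close> will be the union of all parts.\<close>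

definition fat :: "'a set \<Rightarrow> 'a set \<Rightarrow> bool" where
  "fat E P \<longleftrightarrow> finite P \<and> (\<exists>d\<le>2. d + 2 \<le> card P \<and> (\<forall>v\<in>P. card (nbh (E - P) v) \<le> d))"

lemma fat_mono:
  assumes "fat E P" "E' \<subseteq> E" "finite E"
  shows "fat E' P"
  using assms unfolding fat_def
  by (meson Diff_mono card_nbh_mono finite_Diff order_refl order_trans)

text \<open>Parts are added one at a time. At the stage where only the new part \<open>R\<close> is
  explored and \<open>W\<close> is empty, nothing is frozen, so \<open>transversal_step\<close>
  yields a vertex of \<open>R\<close> that is compatible with some transversal of the other
  parts.\<close>

theorem independent_transversal:
  fixes \<P> :: "'a set set"
  assumes "finite \<P>" "pairwise disjnt \<P>" "\<And>P. P \<in> \<P> \<Longrightarrow> fat (\<Union>\<P>) P"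
  shows "\<exists>T. (\<forall>P\<in>\<P>. T P \<in> P) \<and> (\<forall>P\<in>\<P>. \<forall>Q\<in>\<P>. \<not> adj (T P) (T Q))"
  using assms
proof (induction "card \<P>" arbitrary: \<P>)
  case 0
  then show ?case by auto
next
  case (Suc n)
  then obtain R where R: "R \<in> \<P>" by fastforce
  have finP: "finite P" if "P \<in> \<P>" for P using Suc.prems(3)[OF that] by (simp add: fat_def)
  have "\<exists>T. (\<forall>P\<in>\<P>-{R}. T P \<in> P) \<and> (\<forall>P\<in>\<P>-{R}. \<forall>Q\<in>\<P>-{R}. \<not> adj (T P) (T Q))"
  proof (rule Suc.hyps(1))
    show "n = card (\<P> - {R})" using Suc.hyps(2) R Suc.prems(1) by simp
    show "pairwise disjnt (\<P> - {R})" using Suc.prems(2) by (rule pairwise_subset) auto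
    show "fat (\<Union>(\<P> - {R})) P" if "P \<in> \<P> - {R}" for P
      by (rule fat_mono[of "\<Union>\<P>"]) (use Suc.prems finP that in auto)
  qed (use Suc.prems in auto)
  then obtain T0 where T0: "\<forall>P\<in>\<P>-{R}. T0 P \<in> P" "\<forall>P\<in>\<P>-{R}. \<forall>Q\<in>\<P>-{R}. \<not> adj (T0 P) (T0 Q)"
    by blast
  have "\<forall>P\<in>\<P>. \<exists>d. d \<le> 2 \<and> d + 2 \<le> card P \<and> (\<forall>v\<in>P. card (nbh (\<Union>\<P> - P) v) \<le> d)"
    using Suc.prems(3) by (simp add: fat_def)
  then obtain d where d: "\<And>P. P \<in> \<P> \<Longrightarrow> d P \<le> 2 \<and> d P + 2 \<le> card P \<and> (\<forall>v\<in>P. card (nbh (\<Union>\<P> - P) v) \<le> d P)"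
    by metis
  define adm where "adm \<S> W \<tau> T \<longleftrightarrow> (\<forall>P\<in>\<P>-{R}. T P \<in> P) \<and>
      (\<forall>P\<in>\<P>-{R}. \<forall>Q\<in>\<P>-{R}. \<not> adj (T P) (T Q)) \<and>
      (\<forall>P\<in>\<S>-{R}. T P = \<tau> P) \<and> (\<forall>w\<in>W. \<forall>P\<in>\<P>-\<S>. \<not> adj w (T P))" for \<S> W \<tau> T
  have "\<exists>T P w. adm {R} {} T0 T \<and> P \<in> {R} \<and> w \<in> P \<and> (\<forall>Q\<in>\<P>-{R}-{P}. \<not> adj w (T Q)) \<and>
    (\<forall>x\<in>{}. x \<notin> P \<longrightarrow> \<not> adj x w)"
  proof (rule transversal_step[where \<P> = \<P> and D = 2 and d = d and R = R])
    show "\<exists>T. adm {R} {} T0 T" using T0 by (auto simp: adm_def)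
    show "adm \<S> W \<tau> T \<longleftrightarrow> (\<forall>P\<in>\<P>-{R}. T P \<in> P) \<and>
      (\<forall>P\<in>\<P>-{R}. \<forall>Q\<in>\<P>-{R}. \<not> adj (T P) (T Q)) \<and>
      (\<forall>P\<in>\<S>-{R}. T P = \<tau> P) \<and> (\<forall>w\<in>W. \<forall>P\<in>\<P>-\<S>. \<not> adj w (T P))" for \<S> W \<tau> T
      by (rule adm_def)
  qed (use Suc.prems finP R d in \<open>auto simp: add.commute\<close>)
  then obtain T w where T: "adm {R} {} T0 T" "w \<in> R" "\<forall>Q\<in>\<P>-{R}. \<not> adj w (T Q)" by auto
  define T' where "T' = T(R := w)"
  have Tin: "T P \<in> P" if "P \<in> \<P> - {R}" for P
    using T(1) that unfolding adm_def by meson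
  have Tna: "\<not> adj (T P) (T Q)" if "P \<in> \<P> - {R}" "Q \<in> \<P> - {R}" for P Q
    using T(1) that unfolding adm_def by meson
  have "T' P \<in> P" if "P \<in> \<P>" for P
    using Tin[of P] T(2) that by (auto simp: T'_def)
  moreover have "\<not> adj (T' P) (T' Q)" if "P \<in> \<P>" "Q \<in> \<P>" for P Q
    using Tna[of P Q] T(3) that adj_sym[of "T P" w] adj_irrefl[of w] by (auto simp: T'_def)
  ultimately show ?case by (intro exI[of _ T'] conjI ballI)
qed

section \<open>Exact transversals of paths of overlapping 4-sets\<close>

text \<open>Overlaps are disjoint pairs inside 4-sets, so a member meets at most two others. The
  last clause gives every nonempty subfamily a member meeting at most one other, which excludes
  cycles; meeting members therefore form paths. A member meeting no other only has to be
  fat.\<close>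

definition chain_family :: "'a set set \<Rightarrow> bool" where
  "chain_family \<K> \<longleftrightarrow> finite \<K> \<and> (\<forall>K\<in>\<K>. fat (\<Union>\<K>) K) \<and>
    (\<forall>K\<in>\<K>. \<forall>K'\<in>\<K>. K \<noteq> K' \<longrightarrow> K \<inter> K' \<noteq> {} \<longrightarrow>
      card K = 4 \<and> card (K \<inter> K') = 2 \<and> (\<forall>v\<in>K \<inter> K'. nbh (\<Union>\<K>) v \<subseteq> K \<union> K')) \<and>
    (\<forall>K\<in>\<K>. \<forall>K'\<in>\<K>. \<forall>K''\<in>\<K>. K \<noteq> K' \<longrightarrow> K \<noteq> K'' \<longrightarrow> K' \<noteq> K'' \<longrightarrow> K \<inter> K' \<inter> K'' = {}) \<and>
    (\<forall>\<C>. \<C> \<subseteq> \<K> \<longrightarrow> \<C> \<noteq> {} \<longrightarrow>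
      (\<exists>K\<in>\<C>. \<forall>K'\<in>\<C>. \<forall>K''\<in>\<C>. K' \<noteq> K \<longrightarrow> K'' \<noteq> K \<longrightarrow> K \<inter> K' \<noteq> {} \<longrightarrow> K \<inter> K'' \<noteq> {} \<longrightarrow> K' = K''))"

lemma chain_familyD:
  assumes "chain_family \<K>"
  shows "finite \<K>" "K \<in> \<K> \<Longrightarrow> fat (\<Union>\<K>) K"
    "K \<in> \<K> \<Longrightarrow> K' \<in> \<K> \<Longrightarrow> K \<noteq> K' \<Longrightarrow> K \<inter> K' \<noteq> {} \<Longrightarrow> card K = 4"
    "K \<in> \<K> \<Longrightarrow> K' \<in> \<K> \<Longrightarrow> K \<noteq> K' \<Longrightarrow> K \<inter> K' \<noteq> {} \<Longrightarrow> card (K \<inter> K') = 2"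
    "K \<in> \<K> \<Longrightarrow> K' \<in> \<K> \<Longrightarrow> K \<noteq> K' \<Longrightarrow> v \<in> K \<Longrightarrow> v \<in> K' \<Longrightarrow> nbh (\<Union>\<K>) v \<subseteq> K \<union> K'"
    "K \<in> \<K> \<Longrightarrow> K' \<in> \<K> \<Longrightarrow> K'' \<in> \<K> \<Longrightarrow> K \<noteq> K' \<Longrightarrow> K \<noteq> K'' \<Longrightarrow> K' \<noteq> K'' \<Longrightarrow> K \<inter> K' \<inter> K'' = {}"
    "\<C> \<subseteq> \<K> \<Longrightarrow> \<C> \<noteq> {} \<Longrightarrow>
      \<exists>K\<in>\<C>. \<forall>K'\<in>\<C>. \<forall>K''\<in>\<C>. K' \<noteq> K \<longrightarrow> K'' \<noteq> K \<longrightarrow> K \<inter> K' \<noteq> {} \<longrightarrow> K \<inter> K'' \<noteq> {} \<longrightarrow> K' = K''"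
proof -
  note H = assms[unfolded chain_family_def]
  note H3 = H[THEN conjunct2, THEN conjunct2, THEN conjunct1, THEN bspec, THEN bspec, THEN mp, THEN mp]
  show "finite \<K>" by (rule H[THEN conjunct1])
  show "fat (\<Union>\<K>) K" if "K \<in> \<K>"
    by (rule H[THEN conjunct2, THEN conjunct1, THEN bspec, OF that])
  show "card K = 4" if "K \<in> \<K>" "K' \<in> \<K>" "K \<noteq> K'" "K \<inter> K' \<noteq> {}"
    by (rule H3[OF that, THEN conjunct1])
  show "card (K \<inter> K') = 2" if "K \<in> \<K>" "K' \<in> \<K>" "K \<noteq> K'" "K \<inter> K' \<noteq> {}"
    by (rule H3[OF that, THEN conjunct2, THEN conjunct1])
  show "nbh (\<Union>\<K>) v \<subseteq> K \<union> K'" if "K \<in> \<K>" "K' \<in> \<K>" "K \<noteq> K'" "v \<in> K" "v \<in> K'"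
    by (rule H3[OF that(1-3) _, THEN conjunct2, THEN conjunct2, THEN bspec]) (use that(4,5) in auto)
  show "K \<inter> K' \<inter> K'' = {}"
    if "K \<in> \<K>" "K' \<in> \<K>" "K'' \<in> \<K>" "K \<noteq> K'" "K \<noteq> K''" "K' \<noteq> K''"
    by (rule H[THEN conjunct2, THEN conjunct2, THEN conjunct2, THEN conjunct1,
      THEN bspec, THEN bspec, THEN bspec, THEN mp, THEN mp, THEN mp, OF that])
  show "\<exists>K\<in>\<C>. \<forall>K'\<in>\<C>. \<forall>K''\<in>\<C>. K' \<noteq> K \<longrightarrow> K'' \<noteq> K \<longrightarrow> K \<inter> K' \<noteq> {} \<longrightarrow> K \<inter> K'' \<noteq> {} \<longrightarrow> K' = K''"
    if "\<C> \<subseteq> \<K>" "\<C> \<noteq> {}"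
    by (rule H[THEN conjunct2, THEN conjunct2, THEN conjunct2, THEN conjunct2,
      THEN spec, THEN mp, THEN mp, OF that])
qed

text \<open>Common frame of both contractions. Cycles cannot arise because \<open>N\<close> meets at
  most one member of \<open>\<R>\<close> and so is itself an end of any subfamily containing it. The
  old neighbour \<open>K'\<close> demanded in \<open>meet\<close> supplies
  \<open>card K = 4\<close>, which the old family guarantees only for members that meet another
  one.\<close>

lemma chain_family_replace:
  assumes \<K>: "chain_family \<K>" and "\<R> \<subseteq> \<K>" "finite (\<Union>\<K>)" "N \<subseteq> \<Union>\<K>"
    and fat: "fat (\<Union>(insert N \<R>)) N"
    and meet: "\<And>K. K \<in> \<R> \<Longrightarrow> K \<inter> N \<noteq> {} \<Longrightarrow> card N = 4 \<and> card (K \<inter> N) = 2 \<and>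
       (\<forall>v\<in>K \<inter> N. nbh (\<Union>(insert N \<R>)) v \<subseteq> K \<union> N) \<and> (\<exists>K'\<in>\<K>. K' \<noteq> K \<and> K \<inter> K' \<noteq> {})"
    and uniq: "\<And>K K'. K \<in> \<R> \<Longrightarrow> K' \<in> \<R> \<Longrightarrow> K \<inter> N \<noteq> {} \<Longrightarrow> K' \<inter> N \<noteq> {} \<Longrightarrow> K = K'"
    and trip: "\<And>K K'. K \<in> \<R> \<Longrightarrow> K' \<in> \<R> \<Longrightarrow> K \<noteq> K' \<Longrightarrow> K \<inter> K' \<inter> N = {}"
  shows "chain_family (insert N \<R>)"
proof -
  let ?K = "insert N \<R>"
  have sub: "\<Union>?K \<subseteq> \<Union>\<K>" using assms by auto
  have 1: "finite ?K" using chain_familyD(1)[OF \<K>] assms(2) finite_subset by auto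
  have 2: "\<forall>K\<in>?K. fat (\<Union>?K) K"
  proof
    fix K assume "K \<in> ?K"
    then show "fat (\<Union>?K) K"
      using fat fat_mono[OF chain_familyD(2)[OF \<K>, of K] sub assms(3)] assms(2) by auto
  qed
  have old: "card K = 4 \<and> card (K \<inter> K') = 2 \<and> (\<forall>v\<in>K \<inter> K'. nbh (\<Union>?K) v \<subseteq> K \<union> K')"
    if "K \<in> \<R>" "K' \<in> \<R>" "K \<noteq> K'" "K \<inter> K' \<noteq> {}" for K K'
  proof -
    have K: "K \<in> \<K>" "K' \<in> \<K>" using that assms(2) by auto
    have "nbh (\<Union>?K) v \<subseteq> K \<union> K'" if "v \<in> K \<inter> K'" for v
      using chain_familyD(5)[OF \<K> K \<open>K \<noteq> K'\<close>, of v] that nbh_mono[OF sub, of v] by blast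
    then show ?thesis using chain_familyD(3,4)[OF \<K> K that(3,4)] by simp
  qed
  have c4: "card K = 4" if "K \<in> \<R>" "K \<inter> N \<noteq> {}" for K
    using meet[OF that] chain_familyD(3)[OF \<K>, of K] that(1) assms(2) by blast
  have 3: "card K = 4 \<and> card (K \<inter> K') = 2 \<and> (\<forall>v\<in>K \<inter> K'. nbh (\<Union>?K) v \<subseteq> K \<union> K')"
    if "K \<in> ?K" "K' \<in> ?K" "K \<noteq> K'" "K \<inter> K' \<noteq> {}" for K K'
  proof (cases "K = N")
    case True
    then have "K' \<in> \<R>" "K' \<inter> N \<noteq> {}" using that by auto
    from meet[OF this] show ?thesis using True by (simp add: Int_commute Un_commute)
  next
    case False
    then have K: "K \<in> \<R>" using that by simp
    show ?thesis
    proof (cases "K' = N")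
      case True
      then have "K \<inter> N \<noteq> {}" using that by auto
      from meet[OF K this] c4[OF K this] show ?thesis using True by simp
    next
      case False
      then show ?thesis using old[OF K _ that(3,4)] that(2) by simp
    qed
  qed
  have 4: "K \<inter> K' \<inter> K'' = {}"
    if "K \<in> ?K" "K' \<in> ?K" "K'' \<in> ?K" "K \<noteq> K'" "K \<noteq> K''" "K' \<noteq> K''" for K K' K''
  proof -
    have "K = N \<or> K' = N \<or> K'' = N \<or> (K \<in> \<K> \<and> K' \<in> \<K> \<and> K'' \<in> \<K>)"
      using that assms(2) by blast
    then consider "K = N" | "K' = N" | "K'' = N" | "K \<in> \<K>" "K' \<in> \<K>" "K'' \<in> \<K>" by blast
    then show ?thesis
    proof cases
      case 1 then show ?thesis using trip[of K' K''] that by blast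
    next
      case 2 then show ?thesis using trip[of K K''] that by blast
    next
      case 3 then show ?thesis using trip[of K K'] that by blast
    next
      case 4 then show ?thesis using chain_familyD(6)[OF \<K>, of K K' K''] that by blast
    qed
  qed
  have 5: "\<exists>K\<in>\<C>. \<forall>K'\<in>\<C>. \<forall>K''\<in>\<C>. K' \<noteq> K \<longrightarrow> K'' \<noteq> K \<longrightarrow> K \<inter> K' \<noteq> {} \<longrightarrow> K \<inter> K'' \<noteq> {} \<longrightarrow> K' = K''"
    if "\<C> \<subseteq> ?K" "\<C> \<noteq> {}" for \<C>
  proof (cases "N \<in> \<C>")
    case True
    have "\<forall>K'\<in>\<C>. \<forall>K''\<in>\<C>. K' \<noteq> N \<longrightarrow> K'' \<noteq> N \<longrightarrow> N \<inter> K' \<noteq> {} \<longrightarrow> N \<inter> K'' \<noteq> {} \<longrightarrow> K' = K''"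
      using uniq that(1) by (metis Int_commute insert_iff subsetD)
    then show ?thesis using True by blast
  next
    case False
    then have "\<C> \<subseteq> \<K>" using that assms(2) by auto
    then show ?thesis using chain_familyD(7)[OF \<K>] that(2) by blast
  qed
  show ?thesis unfolding chain_family_def
    using 1 2 3 4 5 by (intro conjI ballI allI impI) auto
qed

text \<open>At the end of a path, \<open>K0 = P \<union> A\<close>, \<open>K1 = A \<union> B\<close>, \<open>K2 = B \<union> C\<close> are contracted to \<open>P \<union> C\<close>.
  A transversal that meets \<open>P \<union> C\<close> exactly once is extended by a vertex of \<open>B\<close> if it meets \<open>P\<close> and by
  a vertex of \<open>A\<close> if it meets \<open>C\<close>; no other chosen vertex is adjacent to the new one.\<close>

theorem exact_transversal:
  assumes "chain_family \<K>"
  shows "\<exists>I\<subseteq>\<Union>\<K>. indep I \<and> (\<forall>K\<in>\<K>. \<exists>v. I \<inter> K = {v})"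
  using assms
proof (induction "card \<K>" arbitrary: \<K> rule: less_induct)
  case less
  note D = chain_familyD[OF less.prems]
  have finK: "finite K" if "K \<in> \<K>" for K using D(2)[OF that] by (simp add: fat_def)
  have finU: "finite (\<Union>\<K>)" using D(1) finK by blast
  show ?case
  proof (cases "pairwise disjnt \<K>")
    case True
    then obtain T where T: "\<forall>P\<in>\<K>. T P \<in> P" "\<forall>P\<in>\<K>. \<forall>Q\<in>\<K>. \<not> adj (T P) (T Q)"
      using independent_transversal[of \<K>] D(1,2) by blast
    have "T ` \<K> \<inter> K = {T K}" if "K \<in> \<K>" for K
    proof -
      have "P = K" if "P \<in> \<K>" "T P \<in> K" for P
      proof (rule ccontr)
        assume "P \<noteq> K"
        then have "P \<inter> K = {}" using True that(1) \<open>K \<in> \<K>\<close> by (simp add: pairwise_def disjnt_def)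
        then show False using T(1) that by blast
      qed
      then show ?thesis using T(1) that by auto
    qed
    moreover have "indep (T ` \<K>)" using T(2) by (auto simp: indep_def)
    moreover have "T ` \<K> \<subseteq> \<Union>\<K>" using T(1) by blast
    ultimately show ?thesis by (intro exI[of _ "T ` \<K>"]) simp
  next
    case False
    \<comment> \<open>Isolated members are set aside, so that the end \<open>K0\<close> supplied by
      acyclicity has exactly one neighbour \<open>K1\<close>.\<close>
    define \<D> where "\<D> = {K \<in> \<K>. \<exists>K'\<in>\<K>. K' \<noteq> K \<and> K \<inter> K' \<noteq> {}}"
    have "\<D> \<noteq> {}" "\<D> \<subseteq> \<K>" using False unfolding \<D>_def pairwise_def disjnt_def by blast+
    then obtain K0 where K0: "K0 \<in> \<D>"
      "\<forall>K'\<in>\<D>. \<forall>K''\<in>\<D>. K' \<noteq> K0 \<longrightarrow> K'' \<noteq> K0 \<longrightarrow> K0 \<inter> K' \<noteq> {} \<longrightarrow> K0 \<inter> K'' \<noteq> {} \<longrightarrow> K' = K''"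
      using D(7) by meson
    from K0(1) obtain K1 where K1: "K1 \<in> \<K>" "K1 \<noteq> K0" "K0 \<inter> K1 \<noteq> {}" by (auto simp: \<D>_def)
    have K0K: "K0 \<in> \<K>" using K0(1) by (simp add: \<D>_def)
    have only1: "K' = K1" if "K' \<in> \<K>" "K' \<noteq> K0" "K0 \<inter> K' \<noteq> {}" for K'
    proof -
      have "K' \<in> \<D>" "K1 \<in> \<D>" using that K1 K0K unfolding \<D>_def by blast+
      then show ?thesis using K0(2)[THEN bspec, THEN bspec, THEN mp, THEN mp, THEN mp, THEN mp, of K' K1] K1 that by simp
    qed
    define A where "A = K0 \<inter> K1"
    define P where "P = K0 - A"
    have cA: "card A = 2" and c0: "card K0 = 4" and c1: "card K1 = 4"
      using D(4)[OF K0K K1(1)] D(3)[OF K0K K1(1)] D(3)[OF K1(1) K0K] K1 by (auto simp: A_def Int_commute)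
    have finA: "finite A" using finK[OF K0K] by (simp add: A_def)
    have cP: "card P = 2" unfolding P_def using cA c0 finA by (simp add: card_Diff_subset A_def)
    have K0eq: "K0 = P \<union> A" "P \<inter> A = {}" by (auto simp: P_def A_def)
    have nbA: "nbh (\<Union>\<K>) v \<subseteq> K0 \<union> K1" if "v \<in> A" for v
      using D(5)[OF K0K K1(1)] K1(2) that by (auto simp: A_def)
    have dis0: "K \<inter> K0 = {}" if "K \<in> \<K>" "K \<noteq> K0" "K \<noteq> K1" for K
      using only1 that by blast
    show ?thesis
    proof (cases "\<exists>K2\<in>\<K>. K2 \<noteq> K0 \<and> K2 \<noteq> K1 \<and> K1 \<inter> K2 \<noteq> {}")
      case False
      \<comment> \<open>The path is just \<open>K0\<close>, \<open>K1\<close> and shrinks to its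
        overlap \<open>A\<close>. No neighbours of \<open>A\<close> remain outside it, so two
        vertices are fat with \<open>d = 0\<close>. A transversal of the new family has no vertex of
        \<open>K0 \<union> K1\<close> outside \<open>A\<close>, so it meets both members exactly
        once.\<close>
      define \<R> where "\<R> = \<K> - {K0, K1}"
      have dis: "K \<inter> K0 = {}" "K \<inter> K1 = {}" if "K \<in> \<R>" for K
        using False dis0 that by (auto simp: \<R>_def)
      have "fat (\<Union>(insert A \<R>)) A"
      proof -
        have "nbh (\<Union>(insert A \<R>) - A) v = {}" if "v \<in> A" for v
          using nbA[OF that] dis by (fastforce simp: nbh_def \<R>_def)
        then show ?thesis unfolding fat_def using cA finA by (intro conjI exI[of _ 0]) auto
      qed
      moreover have "K \<inter> A = {}" if "K \<in> \<R>" for K using dis[OF that] by (auto simp: A_def)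
      ultimately have ch: "chain_family (insert A \<R>)"
        by (intro chain_family_replace[OF less.prems]) (use finU K0K in \<open>auto simp: \<R>_def A_def\<close>)
      have "card (insert A \<R>) < card \<K>"
      proof -
        have "card (insert A \<R>) \<le> Suc (card \<R>)" by (rule card_insert_le_m1) auto
        moreover have "card \<R> = card \<K> - 2" unfolding \<R>_def using K0K K1 D(1) by (simp add: card_Diff_subset)
        moreover have "card \<K> \<ge> card {K0,K1}" using K0K K1 D(1) by (intro card_mono) auto
        ultimately show ?thesis using K1(2) by simp
      qed
      from less.hyps[OF this ch] obtain I where I: "I \<subseteq> \<Union>(insert A \<R>)" "indep I"
        "\<forall>K\<in>insert A \<R>. \<exists>v. I \<inter> K = {v}" by blast
      have xA: "x \<in> A" if "x \<in> I" "x \<in> K0 \<union> K1" for x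
      proof (rule ccontr)
        assume "x \<notin> A"
        then obtain K where "K \<in> \<R>" "x \<in> K" using I(1) \<open>x \<in> I\<close> by auto
        then show False using dis[of K] \<open>x \<in> K0 \<union> K1\<close> by blast
      qed
      have "A \<subseteq> K0" "A \<subseteq> K1" by (auto simp: A_def)
      then have IA: "I \<inter> K0 = I \<inter> A" "I \<inter> K1 = I \<inter> A" using xA by blast+
      obtain a where a: "I \<inter> A = {a}" using I(3) by auto
      have "\<exists>v. I \<inter> K = {v}" if "K \<in> \<K>" for K
      proof (cases "K = K0 \<or> K = K1")
        case True
        then have "I \<inter> K = {a}" using IA a by metis
        then show ?thesis by (rule exI)
      next
        case False
        then have "K \<in> insert A \<R>" using that by (simp add: \<R>_def)
        then show ?thesis by (rule I(3)[THEN bspec])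
      qed
      moreover have "I \<subseteq> \<Union>\<K>" using I(1) K0K by (auto simp: \<R>_def A_def)
      ultimately show ?thesis using I(2) by (intro exI[of _ I]) simp
    next
      case True
      then obtain K2 where K2: "K2 \<in> \<K>" "K2 \<noteq> K0" "K2 \<noteq> K1" "K1 \<inter> K2 \<noteq> {}" by blast
      define B where "B = K1 \<inter> K2"
      define C where "C = K2 - B"
      define N where "N = P \<union> C"
      define \<R> where "\<R> = \<K> - {K0, K1, K2}"
      have cB: "card B = 2" and c2: "card K2 = 4"
        using D(4)[OF K1(1) K2(1)] D(3)[OF K2(1) K1(1)] K2 by (auto simp: B_def Int_commute)
      have finB: "finite B" and finC: "finite C" using finK K1(1) K2(1) by (auto simp: B_def C_def)
      have cC: "card C = 2" unfolding C_def using cB c2 finB by (simp add: card_Diff_subset B_def)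
      have K2eq: "K2 = B \<union> C" "B \<inter> C = {}" by (auto simp: C_def B_def)
      have AB: "A \<inter> B = {}" using D(6)[OF K0K K1(1) K2(1) K1(2)[symmetric] K2(2)[symmetric] K2(3)[symmetric]]
        unfolding A_def B_def by blast
      have K1eq: "K1 = A \<union> B"
      proof -
        have "A \<union> B \<subseteq> K1" by (auto simp: A_def B_def)
        moreover have "card (A \<union> B) = card K1"
          using card_Un_disjoint[OF finA finB AB] cA cB c1 by simp
        ultimately show ?thesis by (rule card_subset_eq[OF finK[OF K1(1)], symmetric])
      qed
      have K02: "K0 \<inter> K2 = {}" using dis0[OF K2(1,2,3)] by blast
      have nbB: "nbh (\<Union>\<K>) v \<subseteq> K1 \<union> K2" if "v \<in> B" for v
        using D(5)[OF K1(1) K2(1)] K2(3) that by (auto simp: B_def)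
      have dis1: "K \<inter> K0 = {}" "K \<inter> K1 = {}" if "K \<in> \<R>" for K
      proof -
        have K: "K \<in> \<K>" "K \<noteq> K0" "K \<noteq> K1" "K \<noteq> K2" using that by (auto simp: \<R>_def)
        show "K \<inter> K0 = {}" using dis0 K by blast
        moreover have "K1 \<inter> K2 \<inter> K = {}"
          by (rule D(6)[OF K1(1) K2(1) K(1) K2(3)[symmetric] K(3)[symmetric] K(4)[symmetric]])
        ultimately show "K \<inter> K1 = {}" using K1eq unfolding A_def B_def by blast
      qed
      \<comment> \<open>\<open>N\<close> inherits the link from \<open>K2\<close> to the next
        member: the overlap of \<open>K2\<close> and \<open>K\<close> has two vertices and avoids
        \<open>B\<close>, so it is \<open>C\<close>.\<close>
      have meetC: "K \<inter> N = C" "K \<inter> K2 = C" if "K \<in> \<R>" "K \<inter> N \<noteq> {}" for K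
      proof -
        have K: "K \<in> \<K>" "K \<noteq> K2" using that by (auto simp: \<R>_def)
        have e: "K \<inter> N = K \<inter> K2" using dis1[OF that(1)] K0eq K1eq K2eq by (auto simp: N_def)
        then have "card (K \<inter> K2) = card C" using D(4)[OF K(1) K2(1) K(2)] that(2) cC by simp
        moreover have "K \<inter> K2 \<subseteq> C" using dis1[OF that(1)] K2eq K1eq by blast
        ultimately show KC: "K \<inter> K2 = C" by (intro card_subset_eq[OF finC])
        show "K \<inter> N = C" unfolding e by (rule KC)
      qed
      have finN: "finite N" and cN: "card N = 4"
      proof -
        have "P \<inter> C = {}" using K02 K0eq K2eq by blast
        moreover have "finite P" using finK[OF K0K] by (simp add: P_def)
        ultimately show "finite N" "card N = 4" using finC cP cC by (auto simp: N_def card_Un_disjoint)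
      qed
      have disAB: "(A \<union> B) \<inter> \<Union>(insert N \<R>) = {}"
        using dis1 K02 K0eq K2eq AB K1eq by (fastforce simp: N_def)
      have Usub: "\<Union>(insert N \<R>) \<subseteq> \<Union>\<K>" using K0K K2(1) by (auto simp: N_def \<R>_def P_def C_def)
      \<comment> \<open>\<open>N\<close> need not be a clique. Once \<open>A\<close> and
        \<open>B\<close> have left the union, everything outside \<open>N\<close> lies outside
        \<open>K0\<close> and \<open>K2\<close>, so the vertices of \<open>P\<close> and
        \<open>C\<close> keep the bound 2 they had in those members.\<close>
      have fatN: "fat (\<Union>(insert N \<R>)) N"
      proof -
        have two: "card (nbh (\<Union>\<K> - K) v) \<le> 2" if "K \<in> \<K>" "v \<in> K" for K v
          using D(2)[OF that(1)] that(2) unfolding fat_def by fastforce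
        have "card (nbh (\<Union>(insert N \<R>) - N) v) \<le> 2" if "v \<in> N" for v
        proof (cases "v \<in> P")
          case True
          have "\<Union>(insert N \<R>) - N \<subseteq> \<Union>\<K> - K0" using Usub disAB K0eq by (auto simp: N_def)
          from card_nbh_mono[OF this, of v] finU two[OF K0K, of v] K0eq True show ?thesis by auto
        next
          case False
          then have "v \<in> K2" using that by (auto simp: N_def C_def)
          have "\<Union>(insert N \<R>) - N \<subseteq> \<Union>\<K> - K2" using Usub disAB K2eq by (auto simp: N_def)
          from card_nbh_mono[OF this, of v] finU two[OF K2(1), of v] \<open>v \<in> K2\<close> show ?thesis by auto
        qed
        then show ?thesis unfolding fat_def using finN cN by (intro conjI exI[of _ 2]) auto
      qed
      have ch: "chain_family (insert N \<R>)"
      proof (rule chain_family_replace[OF less.prems _ finU _ fatN])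
        show "\<R> \<subseteq> \<K>" "N \<subseteq> \<Union>\<K>" using Usub by (auto simp: \<R>_def)
      next
        fix K assume K: "K \<in> \<R>" "K \<inter> N \<noteq> {}"
        have KK: "K \<in> \<K>" "K \<noteq> K2" using K by (auto simp: \<R>_def)
        have "nbh (\<Union>(insert N \<R>)) v \<subseteq> K \<union> N" if "v \<in> K \<inter> N" for v
        proof -
          have v: "v \<in> K" "v \<in> K2" using that meetC[OF K] by auto
          have "nbh (\<Union>\<K>) v \<subseteq> K \<union> K2" using D(5)[OF KK(1) K2(1) KK(2) v] .
          then show ?thesis using nbh_mono[OF Usub, of v] disAB K2eq by (fastforce simp: nbh_def N_def)
        qed
        moreover have "K \<inter> K2 \<noteq> {}" using meetC[OF K] cC by auto
        ultimately show "card N = 4 \<and> card (K \<inter> N) = 2 \<and>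
          (\<forall>v\<in>K \<inter> N. nbh (\<Union>(insert N \<R>)) v \<subseteq> K \<union> N) \<and> (\<exists>K'\<in>\<K>. K' \<noteq> K \<and> K \<inter> K' \<noteq> {})"
          using meetC[OF K] cC cN KK K2(1) by auto
      next
        fix K K' assume K: "K \<in> \<R>" "K' \<in> \<R>" "K \<inter> N \<noteq> {}" "K' \<inter> N \<noteq> {}"
        show "K = K'"
        proof (rule ccontr)
          assume "K \<noteq> K'"
          then have "K2 \<inter> K \<inter> K' = {}" by (intro D(6)) (use K K2(1) in \<open>auto simp: \<R>_def\<close>)
          then have "C = {}" using meetC(2)[OF K(1,3)] meetC(2)[OF K(2,4)] by blast
          then show False using cC by simp
        qed
      next
        fix K K' assume K: "K \<in> \<R>" "K' \<in> \<R>" "K \<noteq> K'"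
        have "K2 \<inter> K \<inter> K' = {}" by (rule D(6)) (use K K2(1) in \<open>auto simp: \<R>_def\<close>)
        moreover have "K \<inter> N \<subseteq> K2"
          using meetC(1)[OF K(1)] K2eq(1) by (cases "K \<inter> N = {}") simp_all
        ultimately show "K \<inter> K' \<inter> N = {}" by blast
      qed
      have "card (insert N \<R>) < card \<K>"
      proof -
        have "card (insert N \<R>) \<le> Suc (card \<R>)" by (rule card_insert_le_m1) auto
        moreover have "card \<R> = card \<K> - 3" unfolding \<R>_def
          using K0K K1 K2 D(1) by (simp add: card_Diff_subset)
        moreover have "card \<K> \<ge> card {K0,K1,K2}" using K0K K1 K2 D(1) by (intro card_mono) auto
        ultimately show ?thesis using K1(2) K2 by simp
      qed
      from less.hyps[OF this ch] obtain I where I: "I \<subseteq> \<Union>(insert N \<R>)" "indep I"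
        "\<forall>K\<in>insert N \<R>. \<exists>v. I \<inter> K = {v}" by blast
      then obtain v where v: "I \<inter> N = {v}" by blast
      have "I \<inter> (A \<union> B) = {}" using I(1) disAB by blast
      define w where "w = (SOME w. w \<in> (if v \<in> P then B else A))"
      have w: "w \<in> (if v \<in> P then B else A)"
        unfolding w_def by (rule someI_ex) (use cA cB in \<open>auto split: if_splits simp: ex_in_conv\<close>)
      have wK: "w \<in> \<Union>\<K>" using w K1eq K1(1) by (auto split: if_splits)
      have PC: "P \<inter> C = {}" using K02 K0eq K2eq by blast
      \<comment> \<open>Exactness is used here: neighbours of \<open>w\<close> in \<open>I\<close>
        could only lie in the half of \<open>N\<close> that does not contain \<open>v\<close>, but
        \<open>v\<close> is the only vertex of \<open>I\<close> in \<open>N\<close>.\<close>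
      have nw: "\<not> adj w x" if "x \<in> I" for x
      proof
        assume "adj w x"
        moreover have "x \<in> \<Union>\<K>" using that I(1) Usub by blast
        ultimately have x: "x \<in> nbh (\<Union>\<K>) w" by (simp add: nbh_def)
        show False
        proof (cases "v \<in> P")
          case True
          then have "x \<in> C" using nbB[of w] w x K1eq K2eq \<open>I \<inter> (A \<union> B) = {}\<close> that by auto
          then have "x = v" using v that by (auto simp: N_def)
          then show False using \<open>x \<in> C\<close> True PC by blast
        next
          case False
          then have "x \<in> P" using nbA[of w] w x K1eq K0eq \<open>I \<inter> (A \<union> B) = {}\<close> that by auto
          then have "x = v" using v that by (auto simp: N_def)
          then show False using \<open>x \<in> P\<close> False by blast
        qed
      qed
      have "indep (insert w I)" using I(2) nw adj_sym adj_irrefl unfolding indep_def by blast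
      moreover have "insert w I \<subseteq> \<Union>\<K>" using wK subset_trans[OF I(1) Usub] by (rule insert_subsetI)
      moreover have "\<exists>u. insert w I \<inter> K = {u}" if "K \<in> \<K>" for K
      proof -
        have IAB: "I \<inter> A = {}" "I \<inter> B = {}" using \<open>I \<inter> (A \<union> B) = {}\<close> by auto
        have eqs: "insert w I \<inter> K0 = {v} \<and> insert w I \<inter> K1 = {w} \<and> insert w I \<inter> K2 = {w}" if "v \<in> P"
        proof -
          have vI: "v \<in> I" "I \<inter> P \<subseteq> {v}" "I \<inter> C \<subseteq> {v}" using v by (auto simp: N_def)
          then have "I \<inter> P = {v}" "I \<inter> C = {}" using that PC by auto
          moreover have "w \<in> B" "w \<notin> K0" using w that K02 K2eq by auto
          ultimately show ?thesis using IAB unfolding K1eq K2eq(1) K0eq(1) by blast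
        qed
        have eqs': "insert w I \<inter> K0 = {w} \<and> insert w I \<inter> K1 = {w} \<and> insert w I \<inter> K2 = {v}" if "v \<notin> P"
        proof -
          have vI: "v \<in> I" "v \<in> N" "I \<inter> P \<subseteq> {v}" "I \<inter> C \<subseteq> {v}" using v by (auto simp: N_def)
          then have "v \<in> C" using that by (simp add: N_def)
          then have "I \<inter> P = {}" "I \<inter> C = {v}" using vI that by auto
          moreover have "w \<in> A" "w \<notin> K2" using w that K02 K0eq by auto
          ultimately show ?thesis using IAB unfolding K1eq K2eq(1) K0eq(1) by blast
        qed
        have "K \<in> \<R> \<or> K = K0 \<or> K = K1 \<or> K = K2" using that by (auto simp: \<R>_def)
        then consider "K \<in> \<R>" | "K = K0" | "K = K1" | "K = K2" by blast
        then show ?thesis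
        proof cases
          case 1
          have "w \<in> K1" using w K1eq by (auto split: if_splits)
          then have "w \<notin> K" using dis1[OF 1] by blast
          then have "insert w I \<inter> K = I \<inter> K" by blast
          then show ?thesis using I(3)[THEN bspec, of K] 1 by simp
        qed (use eqs eqs' in \<open>cases "v \<in> P"; simp\<close>)+
      qed
      ultimately show ?thesis by (intro exI[of _ "insert w I"]) simp
    qed
  qed
qed

subsection \<open>Clusters of cliques\<close>

lemma clique_subset: "clique K \<Longrightarrow> S \<subseteq> K \<Longrightarrow> clique S"
  by (auto simp: clique_def)

lemma clique_card_le:
  assumes "cliques (Suc r) X = {}" "S \<subseteq> X" "clique S"
  shows "card S \<le> r"
proof (rule ccontr)
  assume "\<not> card S \<le> r"
  then obtain T where "T \<subseteq> S" "card T = Suc r"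
    by (metis not_less_eq_eq obtain_subset_with_card_n)
  then have "T \<in> cliques (Suc r) X" using assms(2,3) clique_subset by (auto simp: cliques_def)
  then show False using assms(1) by simp
qed

lemma card_le_Suc_degree:
  assumes "finite X" "U \<subseteq> X" "v \<in> U" "\<And>u. u \<in> U \<Longrightarrow> u \<noteq> v \<Longrightarrow> adj v u"
  shows "card U + card (nbh (X - U) v) \<le> Suc (card (nbh X v))"
proof -
  have finU: "finite U" using assms finite_subset by blast
  have "card U - 1 + card (nbh (X - U) v) = card ((U - {v}) \<union> nbh (X - U) v)"
    using assms finU by (subst card_Un_disjoint) (auto simp: nbh_def card_Diff_singleton)
  also have "\<dots> \<le> card (nbh X v)"
    by (rule card_mono) (use assms in \<open>auto simp: nbh_def\<close>)
  finally show ?thesis by linarith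
qed

lemma card_clique_Un:
  assumes "finite X" "\<And>v. v \<in> X \<Longrightarrow> card (nbh X v) \<le> Suc r"
    and "K \<in> cliques r X" "K' \<in> cliques r X" "K \<inter> K' \<noteq> {}"
  shows "card (K \<union> K') \<le> r + 2" "r \<le> card (K \<inter> K') + 2"
proof -
  obtain v where v: "v \<in> K" "v \<in> K'" using assms(5) by blast
  have K: "K \<subseteq> X" "K' \<subseteq> X" "card K = r" "card K' = r" "clique K" "clique K'"
    using assms(3,4) by (auto simp: cliques_def)
  have fin: "finite K" "finite K'" using K assms(1) finite_subset by auto
  have "card (K \<union> K') + card (nbh (X - (K \<union> K')) v) \<le> Suc (card (nbh X v))"
    using assms(1) v K by (intro card_le_Suc_degree) (auto simp: clique_def)
  then show *: "card (K \<union> K') \<le> r + 2" using assms(2)[of v] v K by force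
  have "card K + card K' = card (K \<union> K') + card (K \<inter> K')" using fin by (rule card_Un_Int)
  then show "r \<le> card (K \<inter> K') + 2" using * K by linarith
qed

text \<open>Adding a clique \<open>K\<close> to a family with intersection \<open>C\<close> and union \<open>U\<close> does not decrease
  \<open>card C + card U\<close>, since \<open>C \<union> (K \<inter> U)\<close> is a clique (Hajnal).\<close>

lemma cluster:
  assumes X: "finite X" "\<And>v. v \<in> X \<Longrightarrow> card (nbh X v) \<le> Suc r" "cliques (Suc r) X = {}"
    and r: "4 \<le> r"
    and \<C>: "\<C> \<subseteq> cliques r X" "\<C> \<noteq> {}" "\<And>K K'. K \<in> \<C> \<Longrightarrow> K' \<in> \<C> \<Longrightarrow> K \<inter> K' \<noteq> {}"
  shows "\<Inter>\<C> \<noteq> {} \<and> 2 * r \<le> card (\<Inter>\<C>) + card (\<Union>\<C>)"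
proof -
  have "finite \<C>" using \<C>(1) X(1) by (auto simp: cliques_def intro: finite_subset[of _ "Pow X"])
  from this \<C>(2,1,3) show ?thesis
  proof (induction rule: finite_ne_induct)
    case (singleton K)
    then show ?case using r by (auto simp: cliques_def)
  next
    case (insert K F)
    define C where "C = \<Inter>F"
    define U where "U = \<Union>F"
    have IH: "C \<noteq> {}" "2 * r \<le> card C + card U" using insert unfolding C_def U_def by auto
    have K: "K \<subseteq> X" "card K = r" "clique K" using insert.prems(1) by (auto simp: cliques_def)
    have F: "K0 \<subseteq> X" "card K0 = r" "clique K0" "K0 \<in> cliques r X" if "K0 \<in> F" for K0
      using insert.prems(1) that by (auto simp: cliques_def)
    have CU: "C \<subseteq> U" "U \<subseteq> X" using insert.hyps(2) F(1) by (auto simp: C_def U_def)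
    have fin: "finite U" "finite C" "finite K"
      by (rule finite_subset[OF CU(2) X(1)], rule finite_subset[OF subset_trans[OF CU] X(1)],
        rule finite_subset[OF K(1) X(1)])
    have CUadj: "adj c u" if "c \<in> C" "u \<in> U" "c \<noteq> u" for c u
    proof -
      from that(2) obtain K0 where "K0 \<in> F" "u \<in> K0" by (auto simp: U_def)
      then show ?thesis using F(3)[of K0] that by (auto simp: C_def clique_def)
    qed
    have cU: "card U \<le> r + 2"
    proof -
      obtain v where v: "v \<in> C" using IH(1) by blast
      have "card U + card (nbh (X - U) v) \<le> Suc (card (nbh X v))"
        by (rule card_le_Suc_degree) (use X(1) CU v CUadj in auto)
      then show ?thesis using X(2)[of v] v CU by force
    qed
    have "clique (C \<union> (K \<inter> U))"
      using CUadj CU(1) K(3) adj_sym unfolding clique_def by blast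
    then have cl: "card (C \<union> (K \<inter> U)) \<le> r"
      using clique_card_le[OF X(3)] CU K(1) by (meson Un_least le_infI1 subset_trans)
    have sum: "2 * r \<le> card (C \<inter> K) + card (U \<union> K)"
    proof -
      have "card C + card (K \<inter> U) = card (C \<union> (K \<inter> U)) + card (C \<inter> (K \<inter> U))"
        using fin by (intro card_Un_Int) auto
      moreover have "C \<inter> (K \<inter> U) = C \<inter> K" using CU(1) by blast
      moreover have "card U + card K = card (U \<union> K) + card (U \<inter> K)"
        using fin by (intro card_Un_Int) auto
      ultimately show ?thesis using cl IH(2) K(2) by (simp add: Int_commute)
    qed
    \<comment> \<open>Otherwise each \<open>K0\<close> in \<open>F\<close> contains the disjoint
      sets \<open>C\<close> and \<open>K \<inter> K0\<close>, each of size at least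
      \<open>r - 2\<close>. For \<open>r \<ge> 4\<close> they fill \<open>K0\<close>, so
      \<open>U\<close> is the clique \<open>C \<union> (K \<inter> U)\<close> and has at most
      \<open>r\<close> vertices. Then \<open>C\<close> has at least \<open>r\<close>, which leaves
      no room for \<open>K \<inter> K0\<close>.\<close>
    have "C \<inter> K \<noteq> {}"
    proof
      assume e: "C \<inter> K = {}"
      have K0: "K0 = C \<union> (K \<inter> K0) \<and> card C + card (K \<inter> K0) = r" if "K0 \<in> F" for K0
      proof -
        have "r \<le> card (K \<inter> K0) + 2"
          by (rule card_clique_Un(2)[OF X(1,2)]) (use insert.prems that in auto)
        moreover have "card (C \<union> (K \<inter> K0)) = card C + card (K \<inter> K0)"
          using e fin by (intro card_Un_disjoint) auto
        moreover have sub: "C \<union> (K \<inter> K0) \<subseteq> K0" using that by (auto simp: C_def)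
        moreover have "finite K0" using F(1)[OF that] X(1) finite_subset by blast
        ultimately have "card (C \<union> (K \<inter> K0)) = card K0" "card (C \<union> (K \<inter> K0)) = card C + card (K \<inter> K0)"
          using card_mono[OF \<open>finite K0\<close> sub] F(2)[OF that] IH(2) cU r by linarith+
        then show ?thesis using card_subset_eq[OF \<open>finite K0\<close> sub] F(2)[OF that] by simp
      qed
      then have "U \<subseteq> C \<union> (K \<inter> U)" unfolding U_def by blast
      then have "card U \<le> r" using cl fin by (meson card_mono finite_Int finite_UnI le_trans)
      then have "r \<le> card C" using IH(2) by linarith
      moreover obtain K0 where K0F: "K0 \<in> F" using insert.hyps(2) by blast
      moreover have "r \<le> card (K \<inter> K0) + 2"
        by (rule card_clique_Un(2)[OF X(1,2)]) (use insert.prems K0F in auto)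
      ultimately show False using K0[OF K0F] r by linarith
    qed
    then show ?case using sum by (simp add: C_def U_def Int_commute Un_commute)
  qed
qed

text \<open>A core vertex is adjacent to the rest of the union \<open>U\<close>, so it has at most
  \<open>d = r + 2 - card U\<close> neighbours beyond \<open>U\<close>. The cluster inequality
  leaves at least \<open>d + 2\<close> vertices even after \<open>r - 4\<close> of them are deleted
  from the core; this freedom allows \<open>P\<close> to be smaller than the core.\<close>

lemma fat_core:
  assumes X: "finite X" "\<And>v. v \<in> X \<Longrightarrow> card (nbh X v) \<le> Suc r" "cliques (Suc r) X = {}"
    and r: "4 \<le> r"
    and \<C>: "\<C> \<subseteq> cliques r X" "\<C> \<noteq> {}" "\<And>K K'. K \<in> \<C> \<Longrightarrow> K' \<in> \<C> \<Longrightarrow> K \<inter> K' \<noteq> {}"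
    and P: "P \<subseteq> \<Inter>\<C>" "card (\<Inter>\<C> - P) + 4 \<le> r"
    and E: "E - P \<subseteq> X - \<Union>\<C>"
  shows "fat E P"
proof -
  define U where "U = \<Union>\<C>"
  have cl: "2 * r \<le> card (\<Inter>\<C>) + card U" using cluster[OF X r \<C>] by (simp add: U_def)
  obtain K where K: "K \<in> \<C>" using \<C>(2) by blast
  have UX: "U \<subseteq> X" using \<C>(1) by (auto simp: cliques_def U_def)
  have KK: "K \<subseteq> X" "card K = r" using K \<C>(1) by (auto simp: cliques_def)
  have fin: "finite U" "finite K" "finite P" "finite (\<Inter>\<C>)"
    using UX KK(1) X(1) P(1) K by (meson Inter_lower finite_subset)+
  have "card K \<le> card U" by (rule card_mono) (use fin K in \<open>auto simp: U_def\<close>)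
  then have rU: "r \<le> card U" using KK by simp
  have degU: "card U + card (nbh (X - U) v) \<le> r + 2" if "v \<in> \<Inter>\<C>" for v
  proof -
    have vU: "v \<in> U" using K that by (auto simp: U_def)
    have "card U + card (nbh (X - U) v) \<le> Suc (card (nbh X v))"
    proof (rule card_le_Suc_degree[OF X(1) UX vU])
      fix u assume u: "u \<in> U" "u \<noteq> v"
      then obtain K' where "K' \<in> \<C>" "u \<in> K'" by (auto simp: U_def)
      then show "adj v u" using that u(2) \<C>(1) by (auto simp: cliques_def clique_def)
    qed
    moreover have "card (nbh X v) \<le> Suc r" using X(2)[of v] vU UX by blast
    ultimately show ?thesis by linarith
  qed
  have deg: "card U + card (nbh (E - P) v) \<le> r + 2" if "v \<in> P" for v
  proof -
    have "card (nbh (E - P) v) \<le> card (nbh (X - U) v)"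
      by (rule card_nbh_mono) (use E X(1) in \<open>auto simp: U_def\<close>)
    then show ?thesis using degU[of v] P(1) that by fastforce
  qed
  have cP: "card (\<Inter>\<C>) = card P + card (\<Inter>\<C> - P)"
    using P(1) fin by (simp add: card_Diff_subset card_mono)
  have "\<Inter>\<C> \<noteq> {}" using cluster[OF X r \<C>] by simp
  then have U2: "card U \<le> r + 2" using degU by fastforce
  have "finite P \<and> (\<exists>d\<le>2. d + 2 \<le> card P \<and> (\<forall>v\<in>P. card (nbh (E - P) v) \<le> d))"
  proof (intro conjI exI[of _ "r + 2 - card U"] ballI)
    show "r + 2 - card U + 2 \<le> card P" using U2 cl cP P(2) by linarith
    show "card (nbh (E - P) v) \<le> r + 2 - card U" if "v \<in> P" for v using deg[OF that] by linarith
  qed (use fin rU in auto)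
  then show ?thesis by (simp add: fat_def)
qed

text \<open>Disjoint \<open>K\<close> and \<open>K''\<close> would cut two disjoint sets of size at
  least \<open>r - 2\<close> out of \<open>K'\<close>, and \<open>2 * (r - 2) > r\<close> for
  \<open>r \<ge> 5\<close>.\<close>

lemma meeting_cliques_trans:
  assumes "finite X" "\<And>v. v \<in> X \<Longrightarrow> card (nbh X v) \<le> Suc r" "5 \<le> r"
    and "K \<in> cliques r X" "K' \<in> cliques r X" "K'' \<in> cliques r X"
    and "K \<inter> K' \<noteq> {}" "K' \<inter> K'' \<noteq> {}"
  shows "K \<inter> K'' \<noteq> {}"
proof
  assume "K \<inter> K'' = {}"
  have "r \<le> card (K \<inter> K') + 2" "r \<le> card (K' \<inter> K'') + 2"
    using card_clique_Un(2)[OF assms(1,2)] assms(4-) by auto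
  moreover have "finite K'" using assms(1,5) by (auto simp: cliques_def intro: finite_subset)
  moreover have "card ((K \<inter> K') \<union> (K' \<inter> K'')) = card (K \<inter> K') + card (K' \<inter> K'')"
    using \<open>K \<inter> K'' = {}\<close> \<open>finite K'\<close> by (intro card_Un_disjoint) auto
  moreover have "card ((K \<inter> K') \<union> (K' \<inter> K'')) \<le> card K'"
    using \<open>finite K'\<close> by (intro card_mono) auto
  moreover have "card K' = r" using assms(5) by (simp add: cliques_def)
  ultimately show False using assms(3) by linarith
qed

section \<open>Independent sets hitting all \<open>r\<close>-cliques\<close>

text \<open>Cores of clusters are disjoint and fat, so they have an independent transversal. The
  members of \<open>\<F>\<close> can be hit along with them: they have at most one neighbour outside
  per vertex and at least three vertices, so they are fat with \<open>d = 1\<close> if no clique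
  meets them, and otherwise they contain nearly all of a core.\<close>

lemma hitting_set:
  assumes X: "finite X" "\<And>v. v \<in> X \<Longrightarrow> card (nbh X v) \<le> Suc r" "cliques (Suc r) X = {}"
    and r: "5 \<le> r"
    and \<F>: "\<And>F. F \<in> \<F> \<Longrightarrow> F \<subseteq> X" "pairwise disjnt \<F>"
      "\<And>F v. F \<in> \<F> \<Longrightarrow> v \<in> F \<Longrightarrow> card (nbh (X - F) v) \<le> 1"
      "\<And>F. F \<in> \<F> \<Longrightarrow> 3 \<le> card F"
  shows "\<exists>I\<subseteq>X. indep I \<and> (\<forall>S \<in> cliques r X \<union> \<F>. I \<inter> S \<noteq> {})"
proof -
  define \<K> where "\<K> = cliques r X"
  define cl where "cl K = {K'\<in>\<K>. K \<inter> K' \<noteq> {}}" for K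
  \<comment> \<open>Placing the part inside the member of \<open>\<F>\<close> met by the cluster
    makes one vertex hit both. If no member is met, the second intersection is over the empty
    family, hence \<open>UNIV\<close>, and the part is the full core.\<close>
  define part where "part K = \<Inter>(cl K) \<inter> \<Inter>{F\<in>\<F>. F \<inter> \<Union>(cl K) \<noteq> {}}" for K
  define \<G> where "\<G> = {F\<in>\<F>. \<forall>K\<in>\<K>. F \<inter> K = {}}"
  define \<P> where "\<P> = part ` \<K> \<union> \<G>"
  have K: "K \<subseteq> X" "card K = r" "clique K" "finite K" if "K \<in> \<K>" for K
    using that finite_subset[OF _ X(1)] by (auto simp: \<K>_def cliques_def)
  have tr: "K \<inter> K'' \<noteq> {}" if "K \<in> \<K>" "K' \<in> \<K>" "K'' \<in> \<K>" "K \<inter> K' \<noteq> {}" "K' \<inter> K'' \<noteq> {}" for K K' K''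
    by (rule meeting_cliques_trans[OF X(1,2) r]) (use that in \<open>auto simp: \<K>_def\<close>)
  have self: "K \<in> cl K" if "K \<in> \<K>" for K using K[OF that] that r by (auto simp: cl_def)
  have clK: "cl K \<subseteq> \<K>" for K by (auto simp: cl_def)
  have cl_pair: "K1 \<inter> K2 \<noteq> {}" if "K \<in> \<K>" "K1 \<in> cl K" "K2 \<in> cl K" for K K1 K2
    using tr[of K1 K K2] that by (auto simp: cl_def Int_commute)
  have cl_eq: "cl K = cl K'" if "K \<in> \<K>" "K' \<in> \<K>" "K \<inter> K' \<noteq> {}" for K K'
  proof -
    have "K' \<inter> K \<noteq> {}" using that(3) by blast
    then have "(K \<inter> L \<noteq> {}) = (K' \<inter> L \<noteq> {})" if "L \<in> \<K>" for L
      using tr[of K K' L] tr[of K' K L] \<open>K \<in> \<K>\<close> \<open>K' \<in> \<K>\<close> \<open>K \<inter> K' \<noteq> {}\<close> that by blast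
    then show ?thesis by (auto simp: cl_def)
  qed
  have part_sub: "part K \<subseteq> K" if "K \<in> \<K>" for K
    using self[OF that] by (auto simp: part_def)
  have away: "K' \<inter> \<Union>(cl K) = {}" if "K \<in> \<K>" "K' \<in> \<K>" "K' \<notin> cl K" for K K'
  proof (rule ccontr)
    assume "K' \<inter> \<Union>(cl K) \<noteq> {}"
    then obtain L where "L \<in> cl K" "L \<inter> K' \<noteq> {}" by blast
    then have "K \<inter> K' \<noteq> {}" using tr[of K L K'] that by (simp add: cl_def)
    then show False using that by (simp add: cl_def)
  qed
  \<comment> \<open>Vertices of \<open>K\<close> outside \<open>F\<close> are outside neighbours of
    a vertex in \<open>K \<inter> F\<close>.\<close>
  have F1: "card (K - F) \<le> 1" if "K \<in> \<K>" "F \<in> \<F>" "F \<inter> K \<noteq> {}" for K F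
  proof -
    from that(3) obtain v where v: "v \<in> F" "v \<in> K" by blast
    have "K - F \<subseteq> nbh (X - F) v"
      using K[OF that(1)] v by (auto simp: nbh_def clique_def)
    then have "card (K - F) \<le> card (nbh (X - F) v)"
      using X(1) by (intro card_mono finite_nbh) auto
    then show ?thesis using \<F>(3)[OF that(2) v(1)] by linarith
  qed
  \<comment> \<open>A member of \<open>\<F>\<close> meeting one clique \<open>L\<close> of the
    cluster meets all: \<open>L \<inter> K'\<close> has at least three vertices and at most one of
    them is outside \<open>F\<close>.\<close>
  have FU: "card (K' - F) \<le> 1" if "K \<in> \<K>" "F \<in> \<F>" "F \<inter> \<Union>(cl K) \<noteq> {}" "K' \<in> cl K" for K K' F
  proof -
    from that(3) obtain L where L: "L \<in> cl K" "F \<inter> L \<noteq> {}" by blast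
    have LK: "L \<in> \<K>" "K' \<in> \<K>" using L that clK by auto
    have "r \<le> card (L \<inter> K') + 2"
      using card_clique_Un(2)[OF X(1,2), of L K'] cl_pair[OF that(1) L(1) that(4)] LK by (simp add: \<K>_def)
    moreover have "card (L \<inter> K' - F) \<le> card (L - F)" using K(4)[OF LK(1)] by (intro card_mono) auto
    moreover have "card (L - F) \<le> 1" by (rule F1[OF LK(1) that(2) L(2)])
    ultimately have "L \<inter> K' - F \<noteq> L \<inter> K'" using r by auto
    then have "F \<inter> K' \<noteq> {}" by blast
    then show ?thesis by (rule F1[OF LK(2) that(2)])
  qed
  \<comment> \<open>Two disjoint members of \<open>\<F>\<close> would each miss at most one vertex
    of \<open>K\<close>, leaving \<open>K\<close> with at most two vertices.\<close>
  have partF: "part K = \<Inter>(cl K) \<inter> F" if KF: "K \<in> \<K>" "F \<in> \<F>" "F \<inter> \<Union>(cl K) \<noteq> {}" for K F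
  proof -
    have "F' = F" if F': "F' \<in> \<F>" "F' \<inter> \<Union>(cl K) \<noteq> {}" for F'
    proof (rule ccontr)
      assume "F' \<noteq> F"
      then have "F' \<inter> F = {}" using \<F>(2) F'(1) \<open>F \<in> \<F>\<close> by (auto simp: pairwise_def disjnt_def)
      then have "K \<subseteq> (K - F) \<union> (K - F')" by blast
      then have "card K \<le> card ((K - F) \<union> (K - F'))"
        using K(4)[OF \<open>K \<in> \<K>\<close>] by (intro card_mono) auto
      also have "\<dots> \<le> card (K - F) + card (K - F')" by (rule card_Un_le)
      finally show False
        using FU[OF \<open>K \<in> \<K>\<close> F' self[OF \<open>K \<in> \<K>\<close>]] FU[OF KF self[OF KF(1)]] K(2)[OF \<open>K \<in> \<K>\<close>] r
        by linarith
    qed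
    then have "{F\<in>\<F>. F \<inter> \<Union>(cl K) \<noteq> {}} = {F}" using KF by blast
    then show ?thesis by (simp add: part_def)
  qed
  have EX: "\<Union>\<P> \<subseteq> X" using part_sub K(1) \<F>(1) unfolding \<P>_def \<G>_def by blast
  have fat_part: "fat (\<Union>\<P>) (part K)" if "K \<in> \<K>" for K
  proof (rule fat_core[OF X _ clK[of K, unfolded \<K>_def]])
    show "4 \<le> r" using r by simp
    show "cl K \<noteq> {}" using self[OF that] by blast
    show "K1 \<inter> K2 \<noteq> {}" if "K1 \<in> cl K" "K2 \<in> cl K" for K1 K2
      by (rule cl_pair[OF \<open>K \<in> \<K>\<close> that])
    show "part K \<subseteq> \<Inter>(cl K)" by (auto simp: part_def)
    show "card (\<Inter>(cl K) - part K) + 4 \<le> r"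
    proof (cases "\<exists>F\<in>\<F>. F \<inter> \<Union>(cl K) \<noteq> {}")
      case True
      then obtain F where F: "F \<in> \<F>" "F \<inter> \<Union>(cl K) \<noteq> {}" by blast
      have "\<Inter>(cl K) - part K \<subseteq> K - F" unfolding partF[OF that F] using self[OF that] by blast
      then have "card (\<Inter>(cl K) - part K) \<le> card (K - F)" using K(4)[OF that] by (intro card_mono) auto
      then show ?thesis using FU[OF that F self[OF that]] r by linarith
    next
      case False
      then have e: "{F\<in>\<F>. F \<inter> \<Union>(cl K) \<noteq> {}} = {}" by blast
      have "part K = \<Inter>(cl K)" unfolding part_def e by simp
      then show ?thesis using r by simp
    qed
    show "\<Union>\<P> - part K \<subseteq> X - \<Union>(cl K)"
    proof
      fix x assume x: "x \<in> \<Union>\<P> - part K"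
      then obtain P where P: "P \<in> \<P>" "x \<in> P" by blast
      have "x \<notin> \<Union>(cl K)"
      proof (cases "P \<in> \<G>")
        case True
        then show ?thesis using P(2) clK[of K] unfolding \<G>_def by blast
      next
        case False
        then obtain K' where K': "K' \<in> \<K>" "P = part K'" using P(1) by (auto simp: \<P>_def)
        have "K' \<notin> cl K"
        proof
          assume "K' \<in> cl K"
          then have "cl K' = cl K" using cl_eq[OF that K'(1)] by (simp add: cl_def)
          then have "part K' = part K" by (simp add: part_def)
          then show False using x P(2) K'(2) by simp
        qed
        from away[OF that K'(1) this] show ?thesis using part_sub[OF K'(1)] P(2) K'(2) by blast
      qed
      then show "x \<in> X - \<Union>(cl K)" using x EX by blast
    qed
  qed
  have fin\<F>: "finite F" if "F \<in> \<F>" for F using \<F>(1)[OF that] X(1) by (rule finite_subset)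
  have fat_F: "fat (\<Union>\<P>) F" if "F \<in> \<G>" for F
  proof -
    have F: "F \<in> \<F>" using that by (simp add: \<G>_def)
    have "card (nbh (\<Union>\<P> - F) v) \<le> 1" if "v \<in> F" for v
    proof -
      have "card (nbh (\<Union>\<P> - F) v) \<le> card (nbh (X - F) v)"
        using EX X(1) by (intro card_nbh_mono) auto
      then show ?thesis using \<F>(3)[OF F that] by linarith
    qed
    then show ?thesis unfolding fat_def using \<F>(4)[OF F] fin\<F>[OF F] by (intro conjI exI[of _ 1]) auto
  qed
  have "finite (Pow X)" using X(1) by simp
  moreover have "\<P> \<subseteq> Pow X" using EX by blast
  ultimately have fin: "finite \<P>" by (rule rev_finite_subset)
  have disj: "pairwise disjnt \<P>"
  proof (rule pairwiseI)
    have dK: "disjnt (part K) (part K')" if "K \<in> \<K>" "K' \<in> \<K>" "part K \<noteq> part K'" for K K'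
    proof -
      have "K \<inter> K' = {}"
      proof (rule ccontr)
        assume "K \<inter> K' \<noteq> {}"
        then have "cl K = cl K'" using cl_eq that by blast
        then show False using that(3) by (simp add: part_def)
      qed
      then show ?thesis using part_sub that by (fastforce simp: disjnt_def)
    qed
    have dG: "disjnt (part K) F" if "K \<in> \<K>" "F \<in> \<G>" for K F
      using part_sub[OF that(1)] that unfolding \<G>_def disjnt_def by blast
    fix P Q assume PQ: "P \<in> \<P>" "Q \<in> \<P>" "P \<noteq> Q"
    have "disjnt P Q" if "P \<in> \<G>" "Q \<in> \<G>"
      using \<F>(2) that PQ(3) unfolding \<G>_def pairwise_def by blast
    moreover have "P \<in> \<G> \<or> (\<exists>K\<in>\<K>. P = part K)" "Q \<in> \<G> \<or> (\<exists>K\<in>\<K>. Q = part K)"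
      using PQ(1,2) unfolding \<P>_def by blast+
    ultimately show "disjnt P Q" using PQ(3) dK dG disjnt_sym by metis
  qed
  obtain T where T: "\<forall>P\<in>\<P>. T P \<in> P" "\<forall>P\<in>\<P>. \<forall>Q\<in>\<P>. \<not> adj (T P) (T Q)"
    using independent_transversal[OF fin disj] fat_part fat_F unfolding \<P>_def by blast
  have "T ` \<P> \<subseteq> X" using T(1) EX by blast
  moreover have "indep (T ` \<P>)" using T(2) by (auto simp: indep_def)
  moreover have "T ` \<P> \<inter> K \<noteq> {}" if "K \<in> \<K>" for K
  proof -
    have "part K \<in> \<P>" using that by (simp add: \<P>_def)
    then show ?thesis using T(1) part_sub[OF that] by blast
  qed
  moreover have "T ` \<P> \<inter> F \<noteq> {}" if "F \<in> \<F>" for F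
  proof (cases "F \<in> \<G>")
    case True
    then have "F \<in> \<P>" by (simp add: \<P>_def)
    then show ?thesis using T(1) by blast
  next
    case False
    with that obtain K where K': "K \<in> \<K>" "F \<inter> K \<noteq> {}" by (auto simp: \<G>_def)
    then have "F \<inter> \<Union>(cl K) \<noteq> {}" using self by blast
    then have "part K \<subseteq> F" using partF[OF K'(1) that] by blast
    moreover have "part K \<in> \<P>" using K'(1) by (simp add: \<P>_def)
    ultimately show ?thesis using T(1) by blast
  qed
  ultimately show ?thesis unfolding \<K>_def by (intro exI[of _ "T ` \<P>"]) auto
qed

text \<open>A vertex outside \<open>I\<close> without a neighbour in \<open>I\<close> could be
  added, so every remaining vertex loses at least one neighbour. The comparison of sizes is exported
  for the exchange of one vertex for two.\<close>

lemma maximum_hitting_set: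
  assumes "finite X" "\<exists>I\<subseteq>X. indep I \<and> (\<forall>S\<in>\<S>. I \<inter> S \<noteq> {})"
  obtains I where "I \<subseteq> X" "indep I" "\<And>S. S \<in> \<S> \<Longrightarrow> I \<inter> S \<noteq> {}"
    "\<And>J. J \<subseteq> X \<Longrightarrow> indep J \<Longrightarrow> (\<And>S. S \<in> \<S> \<Longrightarrow> J \<inter> S \<noteq> {}) \<Longrightarrow> card J \<le> card I"
    "\<And>v d. v \<in> X - I \<Longrightarrow> card (nbh X v) \<le> Suc d \<Longrightarrow> card (nbh (X - I) v) \<le> d"
proof -
  define P where "P I \<longleftrightarrow> I \<subseteq> X \<and> indep I \<and> (\<forall>S\<in>\<S>. I \<inter> S \<noteq> {})" for I
  obtain I0 where "P I0" using assms(2) unfolding P_def by blast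
  moreover have "card I < Suc (card X)" if "P I" for I
    using that card_mono[OF assms(1)] by (simp add: P_def less_Suc_eq_le)
  ultimately obtain I where I: "P I" "\<And>J. P J \<Longrightarrow> card J \<le> card I"
    using ex_has_greatest_nat[of P I0 card "Suc (card X)"] by blast
  have fI: "finite I" using I(1) finite_subset[OF _ assms(1)] by (simp add: P_def)
  show ?thesis
  proof (rule that)
    show "I \<subseteq> X" "indep I" "\<And>S. S \<in> \<S> \<Longrightarrow> I \<inter> S \<noteq> {}" using I(1) by (auto simp: P_def)
    show "card J \<le> card I" if "J \<subseteq> X" "indep J" "\<And>S. S \<in> \<S> \<Longrightarrow> J \<inter> S \<noteq> {}" for J
      by (rule I(2)) (use that in \<open>simp add: P_def\<close>)
    fix v d assume v: "v \<in> X - I" and d: "card (nbh X v) \<le> Suc d"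
    have "\<exists>u\<in>I. adj v u"
    proof (rule ccontr)
      assume "\<not> (\<exists>u\<in>I. adj v u)"
      then have "\<not> adj v u \<and> \<not> adj u v" if "u \<in> I" for u using that adj_sym[of u v] by blast
      then have "indep (insert v I)" using I(1) adj_irrefl by (auto simp: P_def indep_def)
      moreover have "insert v I \<inter> S \<noteq> {}" if "S \<in> \<S>" for S using I(1) that by (auto simp: P_def)
      ultimately have "P (insert v I)" using I(1) v by (simp add: P_def)
      from I(2)[OF this] show False using v fI by simp
    qed
    then obtain u where "u \<in> I" "adj v u" by blast
    then have "nbh (X - I) v \<subset> nbh X v" using I(1) by (auto simp: nbh_def P_def)
    then have "card (nbh (X - I) v) < card (nbh X v)" by (rule psubset_card_mono[OF finite_nbh[OF assms(1)]])
    then show "card (nbh (X - I) v) \<le> d" using d by linarith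
  qed
qed

subsection \<open>Sets inducing blown-up cycles\<close>

text \<open>The obstruction to hitting all 4-cliques of a graph of maximum degree 5 without 5-cliques
  is a component obtained from an odd cycle by replacing each vertex by an edge. Only its local
  structure matters: every neighbourhood is a butterfly (two triangles sharing a vertex).\<close>

definition butterfly :: "'a set \<Rightarrow> 'a \<Rightarrow> 'a \<Rightarrow> 'a \<Rightarrow> 'a \<Rightarrow> 'a \<Rightarrow> bool" where
  "butterfly N f c c' d d' \<longleftrightarrow> distinct [f, c, c', d, d'] \<and> N = {f, c, c', d, d'} \<and>
    adj f c \<and> adj f c' \<and> adj f d \<and> adj f d' \<and> adj c c' \<and> adj d d' \<and>
    \<not> adj c d \<and> \<not> adj c d' \<and> \<not> adj c' d \<and> \<not> adj c' d'"

definition butterfly_set :: "'a set \<Rightarrow> bool" where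
  "butterfly_set F \<longleftrightarrow> F \<noteq> {} \<and> (\<forall>v\<in>F. \<exists>f c c' d d'. butterfly (nbh F v) f c c' d d')"

lemma butterfly_card: "butterfly N f c c' d d' \<Longrightarrow> card N = 5"
  by (auto simp: butterfly_def)

lemma butterfly_set_card: "butterfly_set F \<Longrightarrow> v \<in> F \<Longrightarrow> card (nbh F v) = 5"
  unfolding butterfly_set_def using butterfly_card by blast

text \<open>The only triangles are \<open>f c c'\<close> and \<open>f d d'\<close>, so the
  non-adjacent pair \<open>c\<close>, \<open>d\<close> meets both. Such a pair later replaces the
  vertex whose neighbourhood is the butterfly.\<close>

lemma butterfly_clique:
  assumes "butterfly N f c c' d d'" "S \<subseteq> N" "clique S" "3 \<le> card S"
  shows "c \<in> S \<or> d \<in> S"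
proof (rule ccontr)
  assume "\<not> (c \<in> S \<or> d \<in> S)"
  then have sub: "S \<subseteq> {f, c', d'}" using assms(1,2) by (auto simp: butterfly_def)
  have "S = {f, c', d'}"
  proof (rule card_seteq[OF _ sub])
    have "card {f, c', d'} \<le> 3" by (simp add: card_insert_if)
    then show "card {f, c', d'} \<le> card S" using assms(4) by linarith
  qed simp
  then show False using assms(1,3) by (auto simp: butterfly_def clique_def)
qed

lemma minimal_butterfly_set:
  assumes "finite X" "F \<subseteq> X" "butterfly_set F"
  obtains F' where "F' \<subseteq> F" "butterfly_set F'" "\<And>G. G \<subset> F' \<Longrightarrow> \<not> butterfly_set G"
proof -
  obtain F' where F': "F' \<subseteq> F \<and> butterfly_set F'"
    "\<And>G. G \<subseteq> F \<and> butterfly_set G \<Longrightarrow> card F' \<le> card G"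
    using ex_has_least_nat[of "\<lambda>G. G \<subseteq> F \<and> butterfly_set G" F card] assms(3) by blast
  have "finite F'" using F'(1) assms(1,2) by (meson finite_subset)
  then have "\<not> butterfly_set G" if "G \<subset> F'" for G
    using F'(1) F'(2)[of G] that psubset_card_mono[of F' G] by fastforce
  then show thesis using that F'(1) by blast
qed

lemma maximal_disjoint_family:
  assumes "finite \<M>" "{} \<notin> \<M>"
  obtains \<F> where "\<F> \<subseteq> \<M>" "pairwise disjnt \<F>" "\<And>F. F \<in> \<M> \<Longrightarrow> \<exists>F'\<in>\<F>. F \<inter> F' \<noteq> {}"
proof -
  have "card \<F> < Suc (card \<M>)" if "\<F> \<subseteq> \<M> \<and> pairwise disjnt \<F>" for \<F>
    using card_mono[OF assms(1), of \<F>] that by simp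
  moreover have "{} \<subseteq> \<M> \<and> pairwise disjnt {}" by simp
  ultimately obtain \<F> where \<F>: "\<F> \<subseteq> \<M> \<and> pairwise disjnt \<F>"
    "\<And>\<G>. \<G> \<subseteq> \<M> \<and> pairwise disjnt \<G> \<Longrightarrow> card \<G> \<le> card \<F>"
    using ex_has_greatest_nat[of "\<lambda>\<F>. \<F> \<subseteq> \<M> \<and> pairwise disjnt \<F>" "{}" card "Suc (card \<M>)"] by blast
  have "\<exists>F'\<in>\<F>. F \<inter> F' \<noteq> {}" if F: "F \<in> \<M>" for F
  proof (rule ccontr)
    assume n: "\<not> (\<exists>F'\<in>\<F>. F \<inter> F' \<noteq> {})"
    have "F \<noteq> {}" using F assms(2) by blast
    then have "F \<notin> \<F>" using n by blast
    have "finite \<F>" using \<F>(1) assms(1) by (meson finite_subset)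
    have "pairwise disjnt (insert F \<F>)"
      using n \<F>(1) by (simp add: pairwise_insert disjnt_def Int_commute)
    then have "card (insert F \<F>) \<le> card \<F>" using \<F>(1) F by (intro \<F>(2)) simp
    then show False using \<open>F \<notin> \<F>\<close> \<open>finite \<F>\<close> by simp
  qed
  then show thesis using that \<F>(1) by blast
qed

lemma card_nbh_Diff:
  assumes "finite X" "F \<subseteq> X"
  shows "card (nbh X v) = card (nbh F v) + card (nbh (X - F) v)"
proof -
  have "nbh X v = nbh F v \<union> nbh (X - F) v" using assms(2) by (auto simp: nbh_def)
  moreover have "finite F" using assms by (meson finite_subset)
  then have "card (nbh F v \<union> nbh (X - F) v) = card (nbh F v) + card (nbh (X - F) v)"
    using assms(1) by (intro card_Un_disjoint finite_nbh) (auto simp: nbh_def)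
  ultimately show ?thesis by simp
qed

text \<open>If a minimal butterfly set \<open>F'\<close> survived, it would meet a member
  \<open>F1\<close> of the maximal family, which \<open>I\<close> hits. Following an edge from
  \<open>F1 \<inter> F'\<close> out of \<open>F'\<close> leads to a vertex \<open>f\<close> of
  \<open>I\<close> that can be exchanged for two vertices of \<open>F'\<close>, against the maximum
  size of \<open>I\<close>.\<close>

lemma hitting_set_no_butterfly_set:
  assumes X: "finite X" "\<And>v. v \<in> X \<Longrightarrow> card (nbh X v) \<le> 6" "cliques 6 X = {}"
  obtains I where "I \<subseteq> X" "indep I" "\<And>K. K \<in> cliques 5 X \<Longrightarrow> I \<inter> K \<noteq> {}"
    "\<And>v. v \<in> X - I \<Longrightarrow> card (nbh (X - I) v) \<le> 5" "\<And>F. F \<subseteq> X - I \<Longrightarrow> \<not> butterfly_set F"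
proof -
  define \<M> where "\<M> = {F. F \<subseteq> X \<and> butterfly_set F \<and> (\<forall>G. G \<subset> F \<longrightarrow> \<not> butterfly_set G)}"
  have "finite \<M>" by (rule finite_subset[of _ "Pow X"]) (use X(1) in \<open>auto simp: \<M>_def\<close>)
  moreover have "{} \<notin> \<M>" by (simp add: \<M>_def butterfly_set_def)
  ultimately obtain \<F> where \<F>: "\<F> \<subseteq> \<M>" "pairwise disjnt \<F>" "\<And>F. F \<in> \<M> \<Longrightarrow> \<exists>F'\<in>\<F>. F \<inter> F' \<noteq> {}"
    by (rule maximal_disjoint_family) blast
  have F: "F \<subseteq> X" "butterfly_set F" "\<And>G. G \<subset> F \<Longrightarrow> \<not> butterfly_set G" if "F \<in> \<F>" for F
    using \<F>(1) that by (auto simp: \<M>_def)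
  have out: "card (nbh (X - F) v) \<le> 1" if "F \<in> \<F>" "v \<in> F" for F v
  proof -
    have "v \<in> X" using F(1) that by blast
    then show ?thesis
      using card_nbh_Diff[OF X(1) F(1)[OF that(1)], of v] butterfly_set_card[OF F(2)[OF that(1)] that(2)] X(2)[of v]
      by linarith
  qed
  have c3: "3 \<le> card F" if "F \<in> \<F>" for F
  proof -
    obtain v where "v \<in> F" using F(2)[OF \<open>F \<in> \<F>\<close>] by (auto simp: butterfly_set_def)
    have "finite F" using F(1)[OF that] X(1) by (rule finite_subset)
    then have "card (nbh F v) \<le> card F" by (rule card_mono) (auto simp: nbh_def)
    then show ?thesis using butterfly_set_card[OF F(2)[OF that] \<open>v \<in> F\<close>] by simp
  qed
  have "\<exists>I\<subseteq>X. indep I \<and> (\<forall>S \<in> cliques 5 X \<union> \<F>. I \<inter> S \<noteq> {})"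
    by (rule hitting_set) (use X F(1) \<F>(2) out c3 in \<open>auto simp: numeral_eq_Suc\<close>)
  from maximum_hitting_set[OF X(1) this]
  obtain I where I: "I \<subseteq> X" "indep I" "\<And>S. S \<in> cliques 5 X \<union> \<F> \<Longrightarrow> I \<inter> S \<noteq> {}"
    "\<And>J. J \<subseteq> X \<Longrightarrow> indep J \<Longrightarrow> (\<And>S. S \<in> cliques 5 X \<union> \<F> \<Longrightarrow> J \<inter> S \<noteq> {}) \<Longrightarrow> card J \<le> card I"
    "\<And>v d. v \<in> X - I \<Longrightarrow> card (nbh X v) \<le> Suc d \<Longrightarrow> card (nbh (X - I) v) \<le> d"
    by blast
  have fI: "finite I" using I(1) X(1) by (rule finite_subset)
  have deg: "card (nbh (X - I) v) \<le> 5" if "v \<in> X - I" for v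
    using I(5)[OF that, of 5] X(2)[of v] that by simp
  have "\<not> butterfly_set F0" if F0: "F0 \<subseteq> X - I" for F0
  proof
    assume "butterfly_set F0"
    have "F0 \<subseteq> X" using F0 by blast
    obtain F' where F': "F' \<subseteq> F0" "butterfly_set F'" "\<And>G. G \<subset> F' \<Longrightarrow> \<not> butterfly_set G"
      using minimal_butterfly_set[OF X(1) \<open>F0 \<subseteq> X\<close> \<open>butterfly_set F0\<close>] by blast
    have F'M: "F' \<subseteq> X - I" using F'(1) F0 by blast
    have "F' \<subseteq> X" using F'M by blast
    have "F' \<in> \<M>" using F'M F'(2,3) by (auto simp: \<M>_def)
    then obtain F1 where F1: "F1 \<in> \<F>" "F' \<inter> F1 \<noteq> {}" using \<F>(3) by blast
    have "I \<inter> F1 \<noteq> {}" using I(3) F1(1) by blast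
    \<comment> \<open>The inclusion is proper because \<open>I\<close> hits \<open>F1\<close> but
      not \<open>F'\<close>. Minimality of \<open>F1\<close> then gives a vertex \<open>p\<close> of
      the intersection whose neighbourhood in \<open>F1\<close> is not contained in
      \<open>F'\<close>.\<close>
    then have "F1 \<inter> F' \<subset> F1" using F'M by blast
    then have "\<not> butterfly_set (F1 \<inter> F')" using F(3)[OF F1(1)] by blast
    then obtain p where p: "p \<in> F1" "p \<in> F'"
      "\<not> (\<exists>f c c' d d'. butterfly (nbh (F1 \<inter> F') p) f c c' d d')"
      using F1(2) unfolding butterfly_set_def by blast
    have "nbh (F1 \<inter> F') p \<noteq> nbh F1 p"
      using p(1,3) F(2)[OF F1(1)] unfolding butterfly_set_def by metis
    then obtain f where f: "f \<in> F1" "adj p f" "f \<notin> F'" by (auto simp: nbh_def)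
    \<comment> \<open>\<open>F'\<close> is 5-regular and degrees in \<open>X - I\<close> are at most
      5, so no edge of \<open>X - I\<close> leaves \<open>F'\<close>.\<close>
    have closed: "x \<in> F'" if "q \<in> F'" "adj q x" "x \<in> X - I" for q x
    proof -
      have "nbh F' q = nbh (X - I) q"
      proof (rule card_seteq)
        have "q \<in> X - I" using that(1) F'M by blast
        then show "card (nbh (X - I) q) \<le> card (nbh F' q)"
          using deg butterfly_set_card[OF F'(2) that(1)] by simp
      qed (use X(1) F'M in \<open>auto simp: nbh_def\<close>)
      moreover have "x \<in> nbh (X - I) q" using that by (simp add: nbh_def)
      ultimately show ?thesis by (auto simp: nbh_def)
    qed
    have "f \<in> X" using f(1) F(1)[OF F1(1)] by blast
    then have fI': "f \<in> I" using closed[OF p(2) f(2)] f(3) by blast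
    obtain g c c' d d' where b: "butterfly (nbh F1 f) g c c' d d'"
      using F(2)[OF F1(1)] f(1) unfolding butterfly_set_def by blast
    have nI: "x \<in> X - I" "adj f x" if "x \<in> nbh F1 f" for x
    proof -
      have x: "adj f x" "x \<in> F1" using that by (auto simp: nbh_def)
      then show "adj f x" by simp
      show "x \<in> X - I" using x F(1)[OF F1(1)] I(2) fI' by (auto simp: indep_def)
    qed
    have mem: "g \<in> nbh F1 f" "c \<in> nbh F1 f" "d \<in> nbh F1 f" using b by (simp_all add: butterfly_def)
    have "p \<in> nbh F1 f" using p(1) f(2) adj_sym by (auto simp: nbh_def)
    \<comment> \<open>The centre \<open>g\<close> of the butterfly links \<open>p\<close> to both
      wings within \<open>X - I\<close>, so \<open>g\<close>, \<open>c\<close> and \<open>d\<close>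
      all fall into \<open>F'\<close> by closure.\<close>
    then have "p = g \<or> adj g p" using b by (auto simp: butterfly_def)
    then have "g \<in> F'" using p(2) closed[OF p(2) _ nI(1)[OF mem(1)]] adj_sym by blast
    moreover have "adj g c" "adj g d" "\<not> adj c d" "c \<noteq> d" using b by (auto simp: butterfly_def)
    ultimately have cd: "c \<in> F'" "d \<in> F'" "\<not> adj c d" "c \<noteq> d" using closed nI(1) mem by blast+
    \<comment> \<open>A vertex of \<open>F'\<close> has degree at most 6 and five neighbours in
      \<open>F'\<close>, so \<open>f\<close> is its only possible neighbour in
      \<open>I\<close>.\<close>
    have only: "u = f" if "q \<in> F'" "adj f q" "u \<in> I" "adj q u" for q u
    proof -
      have qX: "q \<in> X" using that(1) F'M by blast
      have "card (nbh (X - F') q) \<le> 1"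
        using card_nbh_Diff[OF X(1) \<open>F' \<subseteq> X\<close>, of q] butterfly_set_card[OF F'(2) that(1)] X(2)[OF qX]
        by linarith
      moreover have "{u, f} \<subseteq> nbh (X - F') q"
        using that fI' I(1) F'M adj_sym[of f q] by (auto simp: nbh_def)
      then have "card {u, f} \<le> card (nbh (X - F') q)" using X(1) by (intro card_mono finite_nbh) auto
      ultimately have "card {u, f} \<le> 1" by simp
      then show ?thesis by (cases "u = f") auto
    qed
    define J where "J = insert c (insert d (I - {f}))"
    have afc: "adj f c" "adj f d" using nI(2) mem by auto
    have nc: "\<not> adj c u \<and> \<not> adj u c \<and> \<not> adj d u \<and> \<not> adj u d" if "u \<in> I - {f}" for u
      using only[OF cd(1) afc(1), of u] only[OF cd(2) afc(2), of u] that adj_sym[of u c] adj_sym[of u d] by blast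
    have "J \<subseteq> X" using I(1) nI(1) mem by (auto simp: J_def)
    moreover have "indep J" unfolding indep_def J_def
      using nc cd(3) adj_sym[of d c] I(2) adj_irrefl by (auto simp: indep_def)
    moreover have "J \<inter> S \<noteq> {}" if S: "S \<in> cliques 5 X \<union> \<F>" for S
    proof (cases "f \<in> S")
      case False
      then show ?thesis using I(3)[OF S] by (auto simp: J_def)
    next
      case True
      show ?thesis
      proof (cases "S \<in> \<F>")
        case True
        then have "S = F1" using \<F>(2) F1(1) f(1) \<open>f \<in> S\<close> by (auto simp: pairwise_def disjnt_def)
        then show ?thesis using mem(2) by (auto simp: J_def nbh_def)
      next
        case False
        then have K: "S \<subseteq> X" "card S = 5" "clique S" using S by (auto simp: cliques_def)
        have fS: "finite S" using K(1) X(1) by (rule finite_subset)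
        \<comment> \<open>At most one vertex of the 5-clique is outside \<open>F1\<close>, so at
          least three besides \<open>f\<close> form a clique in the butterfly around
          \<open>f\<close>, and \<open>c\<close> or \<open>d\<close> is among them.\<close>
        have "S - {f} - F1 \<subseteq> nbh (X - F1) f" using K True by (auto simp: nbh_def clique_def)
        then have "card (S - {f} - F1) \<le> card (nbh (X - F1) f)"
          using X(1) by (intro card_mono finite_nbh) auto
        then have "card (S - {f} - F1) \<le> 1" using out[OF F1(1) f(1)] by linarith
        moreover have "card (S - {f}) = 4" using K(2) True fS by simp
        moreover have "card (S - {f}) = card ((S - {f}) \<inter> F1) + card (S - {f} - F1)"
          using fS by (metis card_Int_Diff finite_Diff)
        ultimately have "3 \<le> card ((S - {f}) \<inter> F1)" by linarith
        moreover have "(S - {f}) \<inter> F1 \<subseteq> nbh F1 f" using K(3) True by (auto simp: nbh_def clique_def)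
        moreover have "clique ((S - {f}) \<inter> F1)" by (rule clique_subset[OF K(3)]) auto
        ultimately have "c \<in> S \<or> d \<in> S" using butterfly_clique[OF b, of "(S - {f}) \<inter> F1"] by blast
        then show ?thesis by (auto simp: J_def)
      qed
    qed
    ultimately have "card J \<le> card I" by (rule I(4))
    moreover have "c \<notin> I" "d \<notin> I" using nI(1) mem by auto
    then have "card J = Suc (Suc (card (I - {f})))" using fI cd(4) by (simp add: J_def)
    then have "card J = Suc (card I)" using fI fI' by (metis card_Suc_Diff1)
    ultimately show False by simp
  qed
  then show thesis using that I(1-3) deg by blast
qed

subsection \<open>Hitting the 4-cliques\<close>

text \<open>Two disjoint overlaps of size at least 2 fill the 4-set \<open>K1\<close>, so both have
  size exactly 2. The union of two consecutive cliques then has six vertices and exhausts the degree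
  5 of every overlap vertex; all further statements follow from knowing these
  neighbourhoods.\<close>

lemma meeting_4_cliques:
  assumes X: "finite X" "\<forall>v\<in>X. card (nbh X v) \<le> 5" "cliques 5 X = {}"
    and K: "K0 \<in> cliques 4 X" "K1 \<in> cliques 4 X" "K2 \<in> cliques 4 X"
      "K0 \<inter> K1 \<noteq> {}" "K1 \<inter> K2 \<noteq> {}" "K0 \<inter> K1 \<inter> K2 = {}"
  shows "card (K0 \<inter> K1) = 2" "K1 = (K0 \<inter> K1) \<union> (K1 \<inter> K2)" "K0 \<inter> K2 = {}"
    "v \<in> K0 \<inter> K1 \<Longrightarrow> nbh X v = K0 \<union> K1 - {v}"
    "x \<in> K0 - K1 \<Longrightarrow> y \<in> K1 \<inter> K2 \<Longrightarrow> \<not> adj x y"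
    "K \<in> cliques 4 X \<Longrightarrow> K \<inter> (K0 \<inter> K1) \<noteq> {} \<Longrightarrow> K = K0 \<or> K = K1"
proof -
  have X': "card (nbh X v) \<le> Suc 4" if "v \<in> X" for v using X(2) that by fastforce
  have cl: "L \<subseteq> X" "card L = 4" "clique L" "finite L" if "L \<in> cliques 4 X" for L
    using that finite_subset[OF _ X(1)] by (auto simp: cliques_def)
  note c0 = cl[OF K(1)] and c1 = cl[OF K(2)] and c2 = cl[OF K(3)]
  have two: "2 \<le> card (K0 \<inter> K1)" "2 \<le> card (K1 \<inter> K2)"
    using card_clique_Un(2)[OF X(1) X' K(1,2,4)] card_clique_Un(2)[OF X(1) X' K(2,3,5)] by auto
  have sum: "card ((K0 \<inter> K1) \<union> (K1 \<inter> K2)) = card (K0 \<inter> K1) + card (K1 \<inter> K2)"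
    using K(6) c1(4) by (intro card_Un_disjoint) auto
  have le: "card ((K0 \<inter> K1) \<union> (K1 \<inter> K2)) \<le> card K1"
    using c1(4) by (intro card_mono) auto
  show A: "card (K0 \<inter> K1) = 2" using two sum le c1(2) by linarith
  have B: "card (K1 \<inter> K2) = 2" using two sum le c1(2) by linarith
  show K1: "K1 = (K0 \<inter> K1) \<union> (K1 \<inter> K2)"
    by (rule card_subset_eq[OF c1(4), symmetric]) (use sum A B c1(2) in auto)
  \<comment> \<open>A common vertex outside \<open>K1\<close> would be adjacent to both halves of
    \<open>K1\<close> and complete a 5-clique.\<close>
  show K02: "K0 \<inter> K2 = {}"
  proof (rule ccontr)
    assume "K0 \<inter> K2 \<noteq> {}"
    then obtain p where p: "p \<in> K0" "p \<in> K2" "p \<notin> K1" using K(6) by blast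
    have "adj p q" if "q \<in> K1" for q
    proof -
      have "q \<in> K0 \<or> q \<in> K2" "q \<noteq> p" using that K1 p(3) by auto
      then show ?thesis using c0(3) c2(3) p(1,2) by (auto simp: clique_def)
    qed
    then have "clique (insert p K1)" using c1(3) adj_sym unfolding clique_def by blast
    moreover have "card (insert p K1) = 5" "insert p K1 \<subseteq> X" using p c0(1) c1 by auto
    ultimately show False using X(3) by (auto simp: cliques_def)
  qed
  have nb: "nbh X v = L \<union> L' - {v}"
    if L: "L \<in> cliques 4 X" "L' \<in> cliques 4 X" "card (L \<inter> L') = 2" "v \<in> L" "v \<in> L'" for L L' v
  proof (rule card_seteq[symmetric])
    note cL = cl[OF L(1)] and cL' = cl[OF L(2)]
    have "card L + card L' = card (L \<union> L') + card (L \<inter> L')" using cL(4) cL'(4) by (rule card_Un_Int)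
    then have "card (L \<union> L') = 6" using L(3) cL(2) cL'(2) by simp
    then have "card (L \<union> L' - {v}) = 5" using L(4) cL(4) cL'(4) by simp
    then show "card (nbh X v) \<le> card (L \<union> L' - {v})" using X(2) L(4) cL(1) by auto
    show "L \<union> L' - {v} \<subseteq> nbh X v" using cL cL' L(4,5) by (auto simp: nbh_def clique_def)
  qed (rule finite_nbh[OF X(1)])
  have nbA: "nbh X v = K0 \<union> K1 - {v}" if "v \<in> K0 \<inter> K1" for v
    using nb[OF K(1,2) A] that by blast
  then show "v \<in> K0 \<inter> K1 \<Longrightarrow> nbh X v = K0 \<union> K1 - {v}" .
  have nbB: "nbh X v = K1 \<union> K2 - {v}" if "v \<in> K1 \<inter> K2" for v
    using nb[OF K(2,3) B] that by blast
  have na: "\<not> adj x y" if "x \<in> K0 - K1" "y \<in> K1 \<inter> K2" for x y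
  proof
    assume "adj x y"
    then have "x \<in> nbh X y" using that(1) c0(1) adj_sym by (auto simp: nbh_def)
    then show False using nbB[OF that(2)] that(1) K02 by blast
  qed
  then show "x \<in> K0 - K1 \<Longrightarrow> y \<in> K1 \<inter> K2 \<Longrightarrow> \<not> adj x y" .
  show "K = K0 \<or> K = K1" if L: "K \<in> cliques 4 X" "K \<inter> (K0 \<inter> K1) \<noteq> {}"
  proof -
    note cK = cl[OF L(1)]
    obtain a where a: "a \<in> K" "a \<in> K0 \<inter> K1" using L(2) by blast
    have sub: "K \<subseteq> K0 \<union> K1"
    proof
      fix x assume "x \<in> K"
      then have "x = a \<or> x \<in> nbh X a" using cK(1,3) a(1) by (auto simp: nbh_def clique_def)
      then show "x \<in> K0 \<union> K1" using nbA[OF a(2)] a(2) by blast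
    qed
    have "K \<subseteq> K0 \<or> K \<subseteq> K1"
    proof (rule ccontr)
      assume "\<not> (K \<subseteq> K0 \<or> K \<subseteq> K1)"
      then obtain x y where xy: "x \<in> K" "x \<notin> K1" "y \<in> K" "y \<notin> K0" by blast
      then have "x \<in> K0 - K1" "y \<in> K1 \<inter> K2" "x \<noteq> y" using sub K1 by blast+
      then show False using na xy(1,3) cK(3) by (auto simp: clique_def)
    qed
    then show ?thesis using card_subset_eq[OF c0(4)] card_subset_eq[OF c1(4)] cK(2) c0(2) c1(2) by metis
  qed
qed

text \<open>Cliques that are or meet a middle of a path are kept whole, all others are replaced by
  the cores of their clusters. The resulting sets form a chain family; butterfly sets are exactly
  what closed-up paths would produce.\<close>

lemma hitting_set_4:
  assumes X: "finite X" "\<And>v. v \<in> X \<Longrightarrow> card (nbh X v) \<le> 5" "cliques 5 X = {}"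
    and nb: "\<And>F. F \<subseteq> X \<Longrightarrow> \<not> butterfly_set F"
  shows "\<exists>I\<subseteq>X. indep I \<and> (\<forall>K\<in>cliques 4 X. I \<inter> K \<noteq> {})"
proof -
  define \<K> where "\<K> = cliques 4 X"
  \<comment> \<open>\<open>K0\<close> and \<open>K2\<close> are then disjoint by
    \<open>meeting_4_cliques\<close>, so \<open>mid\<close> marks the cliques through which meeting
    fails to be transitive.\<close>
  define mid where "mid K1 \<longleftrightarrow> K1 \<in> \<K> \<and>
    (\<exists>K0\<in>\<K>. \<exists>K2\<in>\<K>. K0 \<inter> K1 \<noteq> {} \<and> K1 \<inter> K2 \<noteq> {} \<and> K0 \<inter> K1 \<inter> K2 = {})" for K1
  define chain where "chain K \<longleftrightarrow> K \<in> \<K> \<and> (\<exists>K1. mid K1 \<and> K \<inter> K1 \<noteq> {})" for K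
  define cl where "cl K = {K'\<in>\<K>. K \<inter> K' \<noteq> {}}" for K
  define core where "core K = \<Inter>(cl K)" for K
  define \<P> where "\<P> = {K. chain K} \<union> core ` {K\<in>\<K>. \<not> chain K}"
  have K: "K \<subseteq> X" "card K = 4" "clique K" "finite K" "K \<noteq> {}" if "K \<in> \<K>" for K
    using that finite_subset[OF _ X(1)] by (auto simp: \<K>_def cliques_def)
  have "\<forall>v\<in>X. card (nbh X v) \<le> 5" using X(2) by blast
  note struct = meeting_4_cliques[OF X(1) this X(3), folded \<K>_def]
  have midI: "mid K1" if "K0 \<in> \<K>" "K1 \<in> \<K>" "K2 \<in> \<K>" "K0 \<inter> K1 \<noteq> {}" "K1 \<inter> K2 \<noteq> {}" "K0 \<inter> K1 \<inter> K2 = {}" for K0 K1 K2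
    unfolding mid_def using that by blast
  have midK: "K1 \<in> \<K>" if "mid K1" for K1 using that by (simp add: mid_def)
  \<comment> \<open>Each vertex of a middle clique lies in one of its two overlaps, and only the two
    cliques forming that overlap contain it.\<close>
  have mid_uniq: "K = K'" if "mid K1" "K \<in> \<K>" "K' \<in> \<K>" "K \<noteq> K1" "K' \<noteq> K1" "v \<in> K" "v \<in> K'" "v \<in> K1" for K1 K K' v
  proof -
    obtain K0 K2 where L: "K1 \<in> \<K>" "K0 \<in> \<K>" "K2 \<in> \<K>" "K0 \<inter> K1 \<noteq> {}" "K1 \<inter> K2 \<noteq> {}" "K0 \<inter> K1 \<inter> K2 = {}"
      using \<open>mid K1\<close> unfolding mid_def by blast
    have L': "K2 \<inter> K1 \<noteq> {}" "K1 \<inter> K0 \<noteq> {}" "K2 \<inter> K1 \<inter> K0 = {}" using L(4-6) by auto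
    have "v \<in> K0 \<inter> K1 \<or> v \<in> K2 \<inter> K1"
      using struct(2)[OF L(2,1,3,4,5,6)] \<open>v \<in> K1\<close> by blast
    then show ?thesis
    proof
      assume "v \<in> K0 \<inter> K1"
      then have "M = K0" if "M \<in> \<K>" "M \<noteq> K1" "v \<in> M" for M
        using struct(6)[OF L(2,1,3,4,5,6), of M] that by blast
      then show ?thesis using that by metis
    next
      assume "v \<in> K2 \<inter> K1"
      then have "M = K2" if "M \<in> \<K>" "M \<noteq> K1" "v \<in> M" for M
        using struct(6)[OF L(3,1,2) L', of M] that by blast
      then show ?thesis using that by metis
    qed
  qed
  have mid_meet: "card (K \<inter> K1) = 2 \<and> (\<forall>v\<in>K \<inter> K1. nbh X v \<subseteq> K \<union> K1)"
    if "mid K1" "K \<in> \<K>" "K \<noteq> K1" "K \<inter> K1 \<noteq> {}" for K1 K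
  proof -
    obtain K0 K2 where L: "K1 \<in> \<K>" "K0 \<in> \<K>" "K2 \<in> \<K>" "K0 \<inter> K1 \<noteq> {}" "K1 \<inter> K2 \<noteq> {}" "K0 \<inter> K1 \<inter> K2 = {}"
      using \<open>mid K1\<close> unfolding mid_def by blast
    have L': "K2 \<inter> K1 \<noteq> {}" "K1 \<inter> K0 \<noteq> {}" "K2 \<inter> K1 \<inter> K0 = {}" using L(4-6) by auto
    have "K0 \<noteq> K1" "K2 \<noteq> K1" using L(4-6) by auto
    have "K = K0 \<or> K = K2"
      using struct(2)[OF L(2,1,3,4,5,6)] struct(6)[OF L(2,1,3,4,5,6) that(2)]
        struct(6)[OF L(3,1,2) L' that(2)] that(3,4) by blast
    then show ?thesis
      using struct(1,4)[OF L(2,1,3,4,5,6)] struct(1,4)[OF L(3,1,2) L'] by blast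
  qed
  have mid_chain: "chain K" if "mid K" for K
    using that midK[OF that] K(5)[OF midK[OF that]] unfolding chain_def by blast
  \<comment> \<open>If neither is middle, take a middle clique \<open>K1\<close> meeting
    \<open>K\<close>. No vertex of \<open>K1\<close> lies in two further cliques, so
    \<open>K\<close> would separate \<open>K1\<close> from \<open>K'\<close> and be middle
    itself.\<close>
  have chain_mid: "mid K \<or> mid K'" if "chain K" "K' \<in> \<K>" "K \<noteq> K'" "K \<inter> K' \<noteq> {}" for K K'
  proof (rule ccontr)
    assume n: "\<not> (mid K \<or> mid K')"
    obtain K1 where K1: "K \<in> \<K>" "mid K1" "K \<inter> K1 \<noteq> {}" using \<open>chain K\<close> unfolding chain_def by blast
    have "K1 \<inter> K \<inter> K' = {}"
    proof (rule ccontr)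
      assume "K1 \<inter> K \<inter> K' \<noteq> {}"
      then obtain v where "v \<in> K1" "v \<in> K" "v \<in> K'" by blast
      then have "K = K'" using mid_uniq[OF K1(2,1) that(2), of v] n K1(2) by blast
      then show False using that(3) by simp
    qed
    then have "mid K" using K1 that by (intro midI[OF midK[OF K1(2)] K1(1) that(2)]) auto
    then show False using n by simp
  qed
  have chain_meet: "chain K'" if "chain K" "K' \<in> \<K>" "K \<inter> K' \<noteq> {}" for K K'
  proof (cases "K = K'")
    case False
    from chain_mid[OF that(1,2) this that(3)] show ?thesis
    proof
      assume "mid K"
      moreover have "K' \<inter> K \<noteq> {}" using that(3) by blast
      ultimately show ?thesis using that(2) unfolding chain_def by blast
    qed (rule mid_chain)
  qed (use that in simp)
  have chainK: "K \<in> \<K>" if "chain K" for K using that by (simp add: chain_def)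
  have non_meet: "\<not> chain K'" if "\<not> chain K" "K \<in> \<K>" "K \<inter> K' \<noteq> {}" for K K'
    using chain_meet[of K' K] that by blast
  have self: "K \<in> cl K" if "K \<in> \<K>" for K using K(5)[OF that] that by (simp add: cl_def)
  have tr: "K0 \<inter> K2 \<noteq> {}" if "\<not> chain K1" "K0 \<in> \<K>" "K1 \<in> \<K>" "K2 \<in> \<K>" "K0 \<inter> K1 \<noteq> {}" "K1 \<inter> K2 \<noteq> {}" for K0 K1 K2
  proof
    assume "K0 \<inter> K2 = {}"
    then have "K0 \<inter> K1 \<inter> K2 = {}" by blast
    then have "mid K1" by (rule midI[OF that(2-6)])
    then show False using mid_chain that(1) by blast
  qed
  have cl_pair: "K1 \<inter> K2 \<noteq> {}" if "\<not> chain K" "K \<in> \<K>" "K1 \<in> cl K" "K2 \<in> cl K" for K K1 K2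
    by (rule tr[of K]) (use that in \<open>auto simp: cl_def\<close>)
  have cl_eq: "cl K = cl K'" if "\<not> chain K" "K \<in> \<K>" "K' \<in> \<K>" "K \<inter> K' \<noteq> {}" for K K'
  proof -
    have "K' \<inter> K \<noteq> {}" "\<not> chain K'" using that(4) non_meet[OF that(1,2,4)] by auto
    then have "(K \<inter> L \<noteq> {}) = (K' \<inter> L \<noteq> {})" if "L \<in> \<K>" for L
      using tr[of K' K L] tr[of K K' L] \<open>\<not> chain K\<close> \<open>K \<in> \<K>\<close> \<open>K' \<in> \<K>\<close> \<open>K \<inter> K' \<noteq> {}\<close> that by blast
    then show ?thesis by (auto simp: cl_def)
  qed
  have core_sub: "core K \<subseteq> K" if "K \<in> \<K>" for K using self[OF that] by (auto simp: core_def)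
  have core_cases: "P = P' \<or> P \<inter> P' = {}" if "P \<in> \<P>" "P' = core K" "K \<in> \<K>" "\<not> chain K" for P P' K
  proof (cases "chain P")
    case True
    then have "K \<inter> P = {}" using non_meet[OF that(4,3), of P] by blast
    then show ?thesis using core_sub[OF that(3)] that(2) by blast
  next
    case False
    with that(1) obtain L where L: "L \<in> \<K>" "\<not> chain L" "P = core L" by (auto simp: \<P>_def)
    show ?thesis
    proof (cases "L \<inter> K = {}")
      case True
      then show ?thesis using core_sub[OF that(3)] core_sub[OF L(1)] that(2) L(3) by blast
    next
      case False
      then show ?thesis using cl_eq[OF L(2,1) that(3)] that(2) L(3) by (simp add: core_def)
    qed
  qed
  have meet_chain: "chain P \<and> chain P'" if PP: "P \<in> \<P>" "P' \<in> \<P>" "P \<noteq> P'" "P \<inter> P' \<noteq> {}" for P P'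
  proof -
    have "chain Q" if "Q \<in> \<P>" "Q' \<in> \<P>" "Q' \<noteq> Q" "Q' \<inter> Q \<noteq> {}" for Q Q'
    proof (rule ccontr)
      assume "\<not> chain Q"
      with that(1) obtain L where "L \<in> \<K>" "\<not> chain L" "Q = core L" by (auto simp: \<P>_def)
      then show False using core_cases[OF that(2)] that(3,4) by blast
    qed
    then show ?thesis using PP by (metis Int_commute)
  qed
  have EX: "\<Union>\<P> \<subseteq> X" using core_sub chainK K(1) unfolding \<P>_def by blast
  have fin: "finite \<P>" by (rule finite_subset[of _ "Pow X"]) (use EX X(1) in auto)
  have fat: "fat (\<Union>\<P>) P" if P: "P \<in> \<P>" for P
  proof (cases "chain P")
    case True
    note cP = K[OF chainK[OF True]]
    have "card (nbh (\<Union>\<P> - P) v) \<le> 2" if "v \<in> P" for v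
    proof -
      \<comment> \<open>Three of at most five neighbours are inside the 4-clique, so at most two are
        outside: fat with \<open>d = 2\<close>.\<close>
      have "card P + card (nbh (X - P) v) \<le> Suc (card (nbh X v))"
        by (rule card_le_Suc_degree) (use X(1) cP that in \<open>auto simp: clique_def\<close>)
      moreover have "card (nbh (\<Union>\<P> - P) v) \<le> card (nbh (X - P) v)"
        using EX X(1) by (intro card_nbh_mono) auto
      moreover have "card (nbh X v) \<le> 5" using X(2) cP(1) that by blast
      ultimately show ?thesis using cP(2) by linarith
    qed
    then show ?thesis unfolding fat_def using cP(2,4) by (intro conjI exI[of _ 2]) auto
  next
    case False
    then obtain L where L: "L \<in> \<K>" "\<not> chain L" "P = core L" using P by (auto simp: \<P>_def)
    show ?thesis
    proof (rule fat_core[where r = 4 and \<C> = "cl L" and X = X])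
      show "cl L \<subseteq> cliques 4 X" by (auto simp: cl_def \<K>_def)
      show "cl L \<noteq> {}" using self[OF L(1)] by blast
      show "K1 \<inter> K2 \<noteq> {}" if "K1 \<in> cl L" "K2 \<in> cl L" for K1 K2
        by (rule cl_pair[OF L(2,1) that])
      show "P \<subseteq> \<Inter>(cl L)" "card (\<Inter>(cl L) - P) + 4 \<le> 4" using L(3) by (simp_all add: core_def)
      show "\<Union>\<P> - P \<subseteq> X - \<Union>(cl L)"
      proof
        fix x assume x: "x \<in> \<Union>\<P> - P"
        then obtain Q where Q: "Q \<in> \<P>" "x \<in> Q" by blast
        have "x \<notin> M" if "M \<in> cl L" for M
        proof
          assume "x \<in> M"
          have M: "M \<in> \<K>" "L \<inter> M \<noteq> {}" using that by (auto simp: cl_def)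
          have nM: "\<not> chain M" using non_meet[OF L(2,1) M(2)] .
          obtain N where N: "N \<in> \<K>" "Q = N \<and> chain N \<or> Q = core N \<and> \<not> chain N"
            using Q(1) chainK by (auto simp: \<P>_def)
          then have "x \<in> N" using Q(2) core_sub[OF N(1)] by blast
          then have "M \<inter> N \<noteq> {}" using \<open>x \<in> M\<close> by blast
          then have "\<not> chain N" "cl M = cl N" using non_meet[OF nM M(1)] cl_eq[OF nM M(1) N(1)] by auto
          then have "Q = P" using N(2) L(3) cl_eq[OF L(2,1) M] by (simp add: core_def)
          then show False using x Q(2) by simp
        qed
        then show "x \<in> X - \<Union>(cl L)" using x EX by blast
      qed
    qed (use X in \<open>auto simp: numeral_eq_Suc\<close>)
  qed
  have meet2: "card P = 4 \<and> card (P \<inter> P') = 2 \<and> (\<forall>v\<in>P \<inter> P'. nbh (\<Union>\<P>) v \<subseteq> P \<union> P')"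
    if PP: "P \<in> \<P>" "P' \<in> \<P>" "P \<noteq> P'" "P \<inter> P' \<noteq> {}" for P P'
  proof -
    have c: "chain P" "chain P'" using meet_chain[OF PP] by auto
    have "P' \<inter> P \<noteq> {}" "P' \<noteq> P" using PP by auto
    then have "card (P \<inter> P') = 2 \<and> (\<forall>v\<in>P \<inter> P'. nbh X v \<subseteq> P \<union> P')"
      using chain_mid[OF c(1) chainK[OF c(2)] PP(3,4)] mid_meet[of P' P] mid_meet[of P P']
        chainK[OF c(1)] chainK[OF c(2)] PP(3,4) by (auto simp: Int_commute Un_commute)
    then show ?thesis using K(2)[OF chainK[OF c(1)]] nbh_mono[OF EX] by blast
  qed
  have triple: "P \<inter> P' \<inter> P'' = {}"
    if PP: "P \<in> \<P>" "P' \<in> \<P>" "P'' \<in> \<P>" "P \<noteq> P'" "P \<noteq> P''" "P' \<noteq> P''" for P P' P''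
  proof (rule ccontr)
    assume "P \<inter> P' \<inter> P'' \<noteq> {}"
    then obtain v where v: "v \<in> P" "v \<in> P'" "v \<in> P''" by blast
    have c: "chain P" "chain P'" "chain P''"
      using meet_chain[OF PP(1,2,4)] meet_chain[OF PP(1,3,5)] v by auto
    have "mid P \<or> mid P'" using chain_mid[OF c(1) chainK[OF c(2)] PP(4)] v by blast
    then show False
      using mid_uniq[of P P' P'' v] mid_uniq[of P' P P'' v] chainK[OF c(1)] chainK[OF c(2)] chainK[OF c(3)] v PP(4-6)
      by metis
  qed
  \<comment> \<open>In a subfamily without an end every member meets two others, whose overlaps
    cover it. So every vertex lies in an overlap and the union is a butterfly set, which is excluded
    by hypothesis.\<close>
  have ends: "\<exists>K\<in>\<C>. \<forall>K'\<in>\<C>. \<forall>K''\<in>\<C>. K' \<noteq> K \<longrightarrow> K'' \<noteq> K \<longrightarrow> K \<inter> K' \<noteq> {} \<longrightarrow> K \<inter> K'' \<noteq> {} \<longrightarrow> K' = K''"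
    if \<C>: "\<C> \<subseteq> \<P>" "\<C> \<noteq> {}" for \<C>
  proof (rule ccontr)
    assume n: "\<not> ?thesis"
    have two: "\<exists>K'\<in>\<C>. \<exists>K''\<in>\<C>. K' \<noteq> K \<and> K'' \<noteq> K \<and> K \<inter> K' \<noteq> {} \<and> K \<inter> K'' \<noteq> {} \<and> K' \<noteq> K''"
      if "K \<in> \<C>" for K
    proof -
      have "\<not> (\<forall>K'\<in>\<C>. \<forall>K''\<in>\<C>. K' \<noteq> K \<longrightarrow> K'' \<noteq> K \<longrightarrow> K \<inter> K' \<noteq> {} \<longrightarrow> K \<inter> K'' \<noteq> {} \<longrightarrow> K' = K'')"
        by (rule notI, rule notE[OF n], rule bexI[OF _ that])
      then show ?thesis by simp
    qed
    \<comment> \<open>Around a vertex of \<open>K \<inter> K'\<close>, the centre is the other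
      vertex of that overlap and the wings are \<open>K' - K\<close> and
      \<open>K \<inter> K''\<close>.\<close>
    have bf: "\<exists>f c c' d d'. butterfly (nbh (\<Union>\<C>) v) f c c' d d'"
      if L: "K \<in> \<C>" "K' \<in> \<C>" "K'' \<in> \<C>" "K' \<noteq> K" "K'' \<noteq> K" "K \<inter> K' \<noteq> {}" "K \<inter> K'' \<noteq> {}" "K' \<noteq> K''"
        and v: "v \<in> K" "v \<in> K'" for K K' K'' v
    proof -
      have P: "K \<in> \<P>" "K' \<in> \<P>" "K'' \<in> \<P>" using L(1-3) \<C>(1) by auto
      have ch: "K \<in> \<K>" "K' \<in> \<K>" "K'' \<in> \<K>"
        using meet_chain[OF P(1,2)] meet_chain[OF P(1,3)] L chainK by auto
      have tri: "K' \<inter> K \<inter> K'' = {}" using triple[OF P(2,1,3)] L by blast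
      have m: "K' \<inter> K \<noteq> {}" using L(6) by blast
      note S = struct[OF ch(2,1,3) m L(7) tri]
      have tri': "K'' \<inter> K \<inter> K' = {}" "K'' \<inter> K \<noteq> {}" using tri L(7) by blast+
      have A: "card (K' \<inter> K) = 2" using S(1) .
      have B: "card (K'' \<inter> K) = 2" using struct(1)[OF ch(3,1,2) tri'(2) L(6) tri'(1)] .
      have fK: "finite K" "finite K'" "card K' = 4" using K ch by auto
      obtain a b where ab: "K' \<inter> K = {a, b}" "a \<noteq> b" using A by (auto simp: card_2_iff)
      define f where "f = (if v = a then b else a)"
      have f: "K' \<inter> K = {v, f}" "v \<noteq> f" using ab v by (auto simp: f_def)
      obtain d d' where d: "K'' \<inter> K = {d, d'}" "d \<noteq> d'" using B by (auto simp: card_2_iff)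
      have "card (K' - K) = 2"
        using A fK card_Diff_subset_Int[of K' K] by simp
      then obtain c c' where c: "K' - K = {c, c'}" "c \<noteq> c'" by (auto simp: card_2_iff)
      have Kd: "K = {v, f, d, d'}" using S(2) f(1) d(1) by (auto simp: Int_commute)
      have Kc: "K' = {v, f, c, c'}" using f(1) c(1) by blast
      have nbv: "nbh (\<Union>\<C>) v = K' \<union> K - {v}"
      proof -
        have "nbh X v = K' \<union> K - {v}" using S(4) v by blast
        moreover have "nbh (\<Union>\<C>) v \<subseteq> nbh X v" by (rule nbh_mono) (use \<C>(1) EX in auto)
        moreover have "K' \<union> K \<subseteq> \<Union>\<C>" using L by blast
        ultimately show ?thesis by (auto simp: nbh_def)
      qed
      have nad: "\<not> adj x y" if "x \<in> {c, c'}" "y \<in> {d, d'}" for x y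
        by (rule S(5)) (use that c(1) d(1) in auto)
      have dist: "distinct [v, f, c, c', d, d']"
      proof -
        have "v \<notin> {c, c'}" "f \<notin> {c, c'}" "d \<notin> {c, c'}" "d' \<notin> {c, c'}"
          using c(1) Kd by blast+
        moreover have "v \<notin> {d, d'}" "f \<notin> {d, d'}" using tri f(1) d(1) by blast+
        ultimately show ?thesis using f(2) c(2) d(2) by auto
      qed
      have "adj x y" if "x \<in> K" "y \<in> K" "x \<noteq> y" for x y using K(3)[OF ch(1)] that by (simp add: clique_def)
      moreover have "adj x y" if "x \<in> K'" "y \<in> K'" "x \<noteq> y" for x y using K(3)[OF ch(2)] that by (simp add: clique_def)
      ultimately have "butterfly (nbh (\<Union>\<C>) v) f c c' d d'"
        unfolding butterfly_def nbv using dist nad Kd Kc by auto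
      then show ?thesis by blast
    qed
    have "butterfly_set (\<Union>\<C>)" unfolding butterfly_set_def
    proof (intro conjI ballI)
      obtain K where "K \<in> \<C>" using \<C>(2) by blast
      with two[OF this] show "\<Union>\<C> \<noteq> {}" by blast
    next
      fix v assume "v \<in> \<Union>\<C>"
      then obtain K where Kv: "K \<in> \<C>" "v \<in> K" by blast
      from two[OF Kv(1)] obtain K' K'' where L: "K' \<in> \<C>" "K'' \<in> \<C>" "K' \<noteq> K" "K'' \<noteq> K" "K \<inter> K' \<noteq> {}" "K \<inter> K'' \<noteq> {}" "K' \<noteq> K''"
        by blast
      have P: "K \<in> \<P>" "K' \<in> \<P>" "K'' \<in> \<P>" using L(1,2) Kv(1) \<C>(1) by auto
      have ch: "K \<in> \<K>" "K' \<in> \<K>" "K'' \<in> \<K>"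
        using meet_chain[OF P(1,2)] meet_chain[OF P(1,3)] L chainK by auto
      have tri: "K' \<inter> K \<inter> K'' = {}" using triple[OF P(2,1,3)] L by blast
      have m: "K' \<inter> K \<noteq> {}" using L(5) by blast
      have "v \<in> K' \<or> v \<in> K''" using struct(2)[OF ch(2,1,3) m L(6) tri] Kv(2) by blast
      then show "\<exists>f c c' d d'. butterfly (nbh (\<Union>\<C>) v) f c c' d d'"
        using bf[OF Kv(1) L Kv(2)] bf[OF Kv(1) L(2,1,4,3,6,5) L(7)[symmetric] Kv(2)] by blast
    qed
    moreover have "\<Union>\<C> \<subseteq> X" using \<C>(1) EX by blast
    ultimately show False using nb by blast
  qed
  have "chain_family \<P>" unfolding chain_family_def
    using fin fat meet2 triple ends by (intro conjI ballI allI impI) simp_all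
  from exact_transversal[OF this]
  obtain I where I: "I \<subseteq> \<Union>\<P>" "indep I" "\<forall>P\<in>\<P>. \<exists>v. I \<inter> P = {v}"
    by (elim exE conjE) (rule that)
  have "I \<inter> K \<noteq> {}" if "K \<in> \<K>" for K
  proof (cases "chain K")
    case True
    then have "K \<in> \<P>" by (simp add: \<P>_def)
    then show ?thesis using I(3) by fastforce
  next
    case False
    then have "core K \<in> \<P>" using that by (simp add: \<P>_def)
    then have "I \<inter> core K \<noteq> {}" using I(3) by fastforce
    then show ?thesis using core_sub[OF that] by blast
  qed
  then show ?thesis using I(1,2) EX unfolding \<K>_def by (intro exI[of _ I]) auto
qed

subsection \<open>Partitions into clique-free parts\<close>

lemma cliques_Diff_hitting:
  assumes "\<And>K. K \<in> cliques r X \<Longrightarrow> I \<inter> K \<noteq> {}"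
  shows "cliques r (X - I) = {}"
proof (rule ccontr)
  assume "cliques r (X - I) \<noteq> {}"
  then obtain K where "K \<subseteq> X - I" "K \<in> cliques r X" by (auto simp: cliques_def)
  then show False using assms by blast
qed

text \<open>Colour 0 is the remainder. Each step of the induction spends one hitting set to lower
  \<open>r\<close>. The base \<open>r = 5\<close> yields two sets together, since the first must be
  chosen so that no butterfly set obstructs the second.\<close>

lemma independent_classes:
  assumes "5 \<le> r" "finite X" "\<And>v. v \<in> X \<Longrightarrow> card (nbh X v) \<le> Suc r" "cliques (Suc r) X = {}"
  shows "\<exists>c. (\<forall>v\<in>X. c v \<le> r - 3) \<and> (\<forall>j\<in>{1..r - 3}. indep {v\<in>X. c v = j}) \<and>
    cliques 4 {v\<in>X. c v = 0} = {}"
  using assms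
proof (induction r arbitrary: X rule: nat_induct_at_least)
  case base
  obtain I2 where I2: "I2 \<subseteq> X" "indep I2" "\<And>K. K \<in> cliques 5 X \<Longrightarrow> I2 \<inter> K \<noteq> {}"
    "\<And>v. v \<in> X - I2 \<Longrightarrow> card (nbh (X - I2) v) \<le> 5" "\<And>F. F \<subseteq> X - I2 \<Longrightarrow> \<not> butterfly_set F"
    by (rule hitting_set_no_butterfly_set[of X]) (use base in \<open>auto simp: numeral_eq_Suc\<close>)
  have "cliques 5 (X - I2) = {}" by (rule cliques_Diff_hitting) (rule I2(3))
  then obtain I1 where I1: "I1 \<subseteq> X - I2" "indep I1" "\<forall>K\<in>cliques 4 (X - I2). I1 \<inter> K \<noteq> {}"
    using hitting_set_4[of "X - I2"] base(1) I2(4,5) by auto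
  define c where "c v = (if v \<in> I2 then 2 else if v \<in> I1 then 1 else 0 :: nat)" for v
  have c: "{v\<in>X. c v = 2} = I2" "{v\<in>X. c v = 1} = I1" "{v\<in>X. c v = 0} = X - I2 - I1"
    using I1(1) I2(1) by (auto simp: c_def)
  have "cliques 4 (X - I2 - I1) = {}" by (rule cliques_Diff_hitting) (use I1(3) in blast)
  moreover have "j = 1 \<or> j = 2" if "j \<in> {1..5 - 3 :: nat}" for j using that by auto
  then have "\<forall>j\<in>{1..5 - 3}. indep {v\<in>X. c v = j}" using c I1(2) I2(2) by metis
  moreover have "\<forall>v\<in>X. c v \<le> 5 - 3" by (simp add: c_def)
  ultimately show ?case using c(3) by (intro exI[of _ c]) simp
next
  case (Suc r)
  have "\<exists>I\<subseteq>X. indep I \<and> (\<forall>S \<in> cliques (Suc r) X \<union> {}. I \<inter> S \<noteq> {})"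
    by (rule hitting_set) (use Suc in auto)
  then have "\<exists>I\<subseteq>X. indep I \<and> (\<forall>S \<in> cliques (Suc r) X. I \<inter> S \<noteq> {})" by simp
  then obtain I where I: "I \<subseteq> X" "indep I" "\<And>S. S \<in> cliques (Suc r) X \<Longrightarrow> I \<inter> S \<noteq> {}"
    "\<And>v d. v \<in> X - I \<Longrightarrow> card (nbh X v) \<le> Suc d \<Longrightarrow> card (nbh (X - I) v) \<le> d"
    using maximum_hitting_set[OF Suc.prems(1)] by metis
  have "cliques (Suc r) (X - I) = {}" by (rule cliques_Diff_hitting) (rule I(3))
  moreover have "card (nbh (X - I) v) \<le> Suc r" if "v \<in> X - I" for v
    using I(4)[OF that] Suc.prems(2)[of v] that by blast
  moreover have "finite (X - I)" using Suc.prems(1) by simp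
  ultimately obtain c where c: "\<forall>v\<in>X - I. c v \<le> r - 3" "\<forall>j\<in>{1..r - 3}. indep {v\<in>X - I. c v = j}"
    "cliques 4 {v\<in>X - I. c v = 0} = {}"
    using Suc.IH[of "X - I"] by auto
  define c' where "c' v = (if v \<in> I then Suc r - 3 else c v)" for v
  have r: "Suc r - 3 = Suc (r - 3)" using Suc.hyps by simp
  have c0: "{v\<in>X. c' v = j} = {v\<in>X - I. c v = j}" if "j < Suc (r - 3)" for j
    using that r by (auto simp: c'_def)
  have cr: "{v\<in>X. c' v = Suc (r - 3)} = I"
  proof -
    have "v \<in> I" if "v \<in> X" "c' v = Suc (r - 3)" for v
    proof (rule ccontr)
      assume "v \<notin> I"
      then have "c v \<le> r - 3" using c(1) that(1) by blast
      moreover have "c v = Suc (r - 3)" using that(2) \<open>v \<notin> I\<close> by (simp add: c'_def)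
      ultimately show False by simp
    qed
    moreover have "c' v = Suc (r - 3)" if "v \<in> I" for v using that r by (simp add: c'_def)
    ultimately show ?thesis using I(1) by blast
  qed
  have "indep {v\<in>X. c' v = j}" if "j \<in> {1..Suc r - 3}" for j
  proof (cases "j = Suc (r - 3)")
    case True
    then show ?thesis using cr I(2) by simp
  next
    case False
    then have j: "j < Suc (r - 3)" "j \<in> {1..r - 3}" using that r by auto
    then show ?thesis using c0[OF j(1)] c(2) by simp
  qed
  moreover have "\<forall>v\<in>X. c' v \<le> Suc r - 3" using c(1) r by (auto simp: c'_def intro: le_SucI)
  moreover have "cliques 4 {v\<in>X. c' v = 0} = {}" using c0[of 0] c(3) by simp
  ultimately show ?case by (intro exI[of _ c']) simp
qed

text \<open>A clique has at most one vertex in each independent class and at most three in the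
  remainder. It thus suffices to distribute the classes so that each part \<open>i\<close> receives
  \<open>q i\<close> of them, with the remainder counted as three in part 1.\<close>

theorem clique_bounded_partition:
  fixes q :: "nat \<Rightarrow> nat"
  assumes r: "5 \<le> r" and X: "finite X" "\<And>v. v \<in> X \<Longrightarrow> card (nbh X v) \<le> Suc r" "cliques (Suc r) X = {}"
    and q: "1 \<le> k" "3 \<le> q 1" "(\<Sum>i=1..k. q i) = r"
  shows "\<exists>m. (\<forall>v\<in>X. m v \<in> {1..k}) \<and>
    (\<forall>i\<in>{1..k}. \<forall>K\<subseteq>{v\<in>X. m v = i}. clique K \<longrightarrow> card K \<le> q i)"
proof -
  obtain c where c: "\<forall>v\<in>X. c v \<le> r - 3" "\<forall>j\<in>{1..r - 3}. indep {v\<in>X. c v = j}"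
    "cliques 4 {v\<in>X. c v = 0} = {}"
    using independent_classes[OF r X] by blast
  \<comment> \<open>The number of independent classes given to part \<open>i\<close>;
    \<open>3 \<le> q 1\<close> keeps the natural subtraction exact.\<close>
  define g where "g i = (if i = 1 then q 1 - 3 else q i)" for i
  have "(\<Sum>i=1..k. g i) = r - 3"
  proof -
    have "(\<Sum>i=1..k. q i) = q 1 + (\<Sum>i\<in>{1..k} - {1}. q i)" using q(1) by (intro sum.remove) auto
    moreover have "(\<Sum>i=1..k. g i) = g 1 + (\<Sum>i\<in>{1..k} - {1}. g i)" using q(1) by (intro sum.remove) auto
    moreover have "(\<Sum>i\<in>{1..k} - {1}. g i) = (\<Sum>i\<in>{1..k} - {1}. q i)" by (intro sum.cong) (auto simp: g_def)
    ultimately show ?thesis using q by (simp add: g_def)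
  qed
  then have "card {1..r - 3} = card (SIGMA i:{1..k}. {..<g i})" by simp
  \<comment> \<open>The second components only number the \<open>g i\<close> places of part
    \<open>i\<close>; the first component is the part to which a class is assigned.\<close>
  then obtain h where h: "bij_betw h {1..r - 3} (SIGMA i:{1..k}. {..<g i})"
    using finite_same_card_bij[of "{1..r - 3}" "SIGMA i:{1..k}. {..<g i}"] by auto
  define m where "m v = (if c v = 0 then 1 else fst (h (c v)))" for v
  have hc: "h (c v) \<in> (SIGMA i:{1..k}. {..<g i})" if "v \<in> X" "c v \<noteq> 0" for v
    using bij_betw_apply[OF h, of "c v"] c(1) that by auto
  have "m v \<in> {1..k}" if "v \<in> X" for v
    using hc[OF that] q(1) by (cases "c v = 0") (auto simp: m_def)
  moreover have "card K \<le> q i" if i: "i \<in> {1..k}" and K: "K \<subseteq> {v\<in>X. m v = i}" "clique K" for i K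
  proof -
    define K0 where "K0 = {v\<in>K. c v = 0}"
    define K1 where "K1 = {v\<in>K. c v \<noteq> 0}"
    have finK: "finite K" by (rule finite_subset[OF _ X(1)]) (use K(1) in auto)
    have "card K0 \<le> 3"
    proof (rule clique_card_le)
      show "cliques (Suc 3) {v\<in>X. c v = 0} = {}" using c(3) by (simp add: numeral_eq_Suc)
      show "K0 \<subseteq> {v\<in>X. c v = 0}" using K(1) by (auto simp: K0_def)
      show "clique K0" by (rule clique_subset[OF K(2)]) (simp add: K0_def)
    qed
    moreover have "K0 = {}" if "i \<noteq> 1"
    proof -
      have "m v = 1 \<and> m v = i" if "v \<in> K0" for v using that K(1) by (auto simp: K0_def m_def)
      then show ?thesis using that by blast
    qed
    moreover have "card K1 \<le> g i"
    proof -
      \<comment> \<open>Adjacent vertices lie in different independent classes, hence in different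
        places.\<close>
      have "inj_on (\<lambda>v. h (c v)) K1"
      proof (rule inj_onI, rule ccontr)
        fix u v assume uv: "u \<in> K1" "v \<in> K1" "h (c u) = h (c v)" "u \<noteq> v"
        have cc: "c u \<in> {1..r - 3}" "c v \<in> {1..r - 3}" "u \<in> X" "v \<in> X"
          using uv(1,2) c(1) K(1) by (auto simp: K1_def)
        then have "c u = c v" using uv(3) bij_betw_imp_inj_on[OF h] by (auto dest: inj_onD)
        moreover have "adj u v" using uv K(2) by (auto simp: K1_def clique_def)
        ultimately show False using c(2) cc by (auto simp: indep_def)
      qed
      moreover have "(\<lambda>v. h (c v)) ` K1 \<subseteq> {i} \<times> {..<g i}"
      proof
        fix x assume "x \<in> (\<lambda>v. h (c v)) ` K1"
        then obtain v where v: "v \<in> X" "c v \<noteq> 0" "m v = i" "x = h (c v)" using K(1) by (auto simp: K1_def)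
        then show "x \<in> {i} \<times> {..<g i}" using hc[OF v(1,2)] by (auto simp: m_def)
      qed
      ultimately have "card K1 \<le> card ({i} \<times> {..<g i})" by (intro card_inj_on_le) auto
      then show ?thesis by simp
    qed
    moreover have "card K = card K0 + card K1"
    proof -
      have "K = K0 \<union> K1" by (auto simp: K0_def K1_def)
      moreover have "card (K0 \<union> K1) = card K0 + card K1"
        using finK by (intro card_Un_disjoint) (auto simp: K0_def K1_def)
      ultimately show ?thesis by simp
    qed
    ultimately show ?thesis using q(2) by (cases "i = 1") (auto simp: g_def)
  qed
  ultimately show ?thesis by blast
qed

end

subsection \<open>Cliques and degrees in digraphs\<close>

lemma (in graph) sym_irrefl_dominates: "sym_irrefl (\<lambda>u v. u \<rightarrow>\<^bsub>G\<^esub> v)"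
proof
  show "v \<rightarrow>\<^bsub>G\<^esub> u" if "u \<rightarrow>\<^bsub>G\<^esub> v" for u v
    using that sym_arcs by (auto simp: symmetric_def dest: symD)
  show "\<not> u \<rightarrow>\<^bsub>G\<^esub> u" for u using no_loops by (auto simp: arcs_ends_conv)
qed

text \<open>Without parallel arcs, \<open>head\<close> is injective on the arcs leaving
  \<open>v\<close>.\<close>

lemma (in graph) card_neighbours_eq_out_degree:
  "card {u \<in> verts G. v \<rightarrow>\<^bsub>G\<^esub> u} = out_degree G v"
proof -
  have "inj_on (head G) (out_arcs G v)"
    by (rule inj_onI) (auto simp: out_arcs_def arc_to_ends_def intro!: no_multi_arcs)
  moreover have "head G ` out_arcs G v = {u \<in> verts G. v \<rightarrow>\<^bsub>G\<^esub> u}"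
    by (auto simp: out_arcs_def arcs_ends_conv image_iff)
  ultimately show ?thesis unfolding out_degree_def by (metis card_image)
qed

lemma (in graph) out_degree_le_max_degree: "v \<in> verts G \<Longrightarrow> out_degree G v \<le> max_degree G"
  unfolding max_degree_def by (rule Max_ge) auto

text \<open>\<open>clique_number\<close> and \<open>clique_free\<close> quantify over arbitrary
  subgraphs; the induced one turns a set of pairwise adjacent vertices into such a witness.\<close>

lemma (in graph) complete_induce_subgraph:
  assumes S: "S \<subseteq> verts G" "\<And>u v. u \<in> S \<Longrightarrow> v \<in> S \<Longrightarrow> u \<noteq> v \<Longrightarrow> u \<rightarrow>\<^bsub>G\<^esub> v"
  shows "subgraph (G \<restriction> S) G" "K\<^bsub>card S\<^esub> (G \<restriction> S)"
proof -
  have ind: "induced_subgraph (G \<restriction> S) G" using S(1) by (rule induced_induce)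
  then show "subgraph (G \<restriction> S) G" by (rule induced_imp_subgraph)
  interpret S: sym_digraph "G \<restriction> S" using ind by (rule induced_graph_imp_graph)
  interpret S': digraph "G \<restriction> S" using ind by (rule digraphI_induced)
  have "graph (G \<restriction> S)" by unfold_locales
  moreover have "arcs_ends (G \<restriction> S) = {(u, v). (u, v) \<in> S \<times> S \<and> u \<noteq> v}"
  proof (intro set_eqI iffI)
    fix x assume "x \<in> arcs_ends (G \<restriction> S)"
    then show "x \<in> {(u, v). (u, v) \<in> S \<times> S \<and> u \<noteq> v}"
      using no_loops by (auto simp: arcs_ends_conv)
  next
    fix x assume "x \<in> {(u, v). (u, v) \<in> S \<times> S \<and> u \<noteq> v}"
    then obtain u v where x: "x = (u, v)" "u \<in> S" "v \<in> S" "u \<noteq> v" by auto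
    then show "x \<in> arcs_ends (G \<restriction> S)" using S(2)[of u v] by (auto simp: arcs_ends_conv image_iff)
  qed
  ultimately show "K\<^bsub>card S\<^esub> (G \<restriction> S)" by (simp add: complete_digraph_def)
qed

lemma (in graph) card_clique_le_clique_number:
  assumes "S \<subseteq> verts G" "\<And>u v. u \<in> S \<Longrightarrow> v \<in> S \<Longrightarrow> u \<noteq> v \<Longrightarrow> u \<rightarrow>\<^bsub>G\<^esub> v"
  shows "card S \<le> clique_number G"
  unfolding clique_number_def
proof (rule Max_ge)
  have "n \<le> card (verts G)" if "\<exists>K. subgraph K G \<and> K\<^bsub>n\<^esub> K" for n
    using that card_mono[OF finite_verts] by (auto simp: complete_digraph_def subgraph_def)
  then have "{n. \<exists>K. subgraph K G \<and> K\<^bsub>n\<^esub> K} \<subseteq> {..card (verts G)}" by auto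
  then show "finite {n. \<exists>K. subgraph K G \<and> K\<^bsub>n\<^esub> K}" by (rule finite_subset) simp
  show "card S \<in> {n. \<exists>K. subgraph K G \<and> K\<^bsub>n\<^esub> K}"
    using complete_induce_subgraph[OF assms] by blast
qed

text \<open>The converse passage: arcs of a complete subgraph come from \<open>G\<close>, so its
  vertices are pairwise adjacent there.\<close>

lemma clique_free_induce_subgraphI:
  assumes "\<And>S. S \<subseteq> V \<Longrightarrow> (\<And>u v. u \<in> S \<Longrightarrow> v \<in> S \<Longrightarrow> u \<noteq> v \<Longrightarrow> u \<rightarrow>\<^bsub>G\<^esub> v) \<Longrightarrow> card S < n"
  shows "clique_free n (G \<restriction> V)"
  unfolding clique_free_def
proof (rule notI, elim exE conjE)
  fix K assume K: "subgraph K (G \<restriction> V)" "K\<^bsub>n\<^esub> K"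
  have "card (verts K) < n"
  proof (rule assms)
    show "verts K \<subseteq> V" using K(1) by (simp add: subgraph_def)
    fix u v assume "u \<in> verts K" "v \<in> verts K" "u \<noteq> v"
    then have "(u, v) \<in> arcs_ends K" using K(2) by (simp add: complete_digraph_def)
    then show "u \<rightarrow>\<^bsub>G\<^esub> v"
      by (rule dominates_induce_subgraphD[OF subsetD[OF arcs_ends_mono[OF K(1)]]])
  qed
  then show False using K(2) by (simp add: complete_digraph_def)
qed

theorem theorem1:
  fixes H :: "('a, 'b) pre_digraph" and k :: nat and p :: "nat \<Rightarrow> nat"
  assumes "graph H"
    and "max_degree H \<ge> 6"
    and "clique_number H \<le> max_degree H - 1"
    and "k \<ge> 1"
    and "\<And>i j. 1 \<le> i \<Longrightarrow> i \<le> j \<Longrightarrow> j \<le> k \<Longrightarrow> p i \<ge> p j"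
    and "\<And>i. 1 \<le> i \<Longrightarrow> i \<le> k \<Longrightarrow> p i \<ge> 2"
    and "(\<Sum>i = 1..k. p i) = max_degree H - 1 + k"
    and "p 1 \<ge> 4"
  shows "\<exists>V :: nat \<Rightarrow> 'a set.
    (\<Union>i\<in>{1..k}. V i) = verts H \<and> disjoint_family_on V {1..k} \<and>
    (\<forall>i\<in>{1..k}. clique_free (p i) (H \<restriction> V i))"
proof -
  interpret graph H by fact
  interpret A: sym_irrefl "\<lambda>u v. u \<rightarrow>\<^bsub>H\<^esub> v" by (rule sym_irrefl_dominates)
  define r where "r = max_degree H - 1"
  have r: "5 \<le> r" "Suc r = max_degree H" using assms(2) by (auto simp: r_def)
  have "card (A.nbh (verts H) v) \<le> Suc r" if "v \<in> verts H" for v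
    using card_neighbours_eq_out_degree[of v] out_degree_le_max_degree[OF that] r(2)
    by (simp add: A.nbh_def)
  moreover have "A.cliques (Suc r) (verts H) = {}"
  proof (rule equals0I)
    fix S assume "S \<in> A.cliques (Suc r) (verts H)"
    then have S: "S \<subseteq> verts H" "card S = Suc r" "A.clique S" by (auto simp: A.cliques_def)
    have "card S \<le> clique_number H"
      by (rule card_clique_le_clique_number[OF S(1)]) (use S(3) in \<open>simp add: A.clique_def\<close>)
    then show False using S(2) assms(3) by (simp add: r_def)
  qed
  \<comment> \<open>Natural subtraction: the summands are rewritten as \<open>(p i - 1) + 1\<close>,
    which is valid because \<open>p i \<ge> 2\<close>.\<close>
  moreover have "(\<Sum>i = 1..k. p i - 1) = r"
  proof -
    have "(\<Sum>i = 1..k. p i) = (\<Sum>i = 1..k. (p i - 1) + 1)"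
      by (intro sum.cong) (use assms(6) in force)+
    also have "\<dots> = (\<Sum>i = 1..k. p i - 1) + k" by (subst sum.distrib) simp
    finally show ?thesis using assms(7) by (simp add: r_def)
  qed
  moreover have "3 \<le> p 1 - 1" using assms(8) by simp
  ultimately have "\<exists>m. (\<forall>v\<in>verts H. m v \<in> {1..k}) \<and>
    (\<forall>i\<in>{1..k}. \<forall>K\<subseteq>{v\<in>verts H. m v = i}. A.clique K \<longrightarrow> card K \<le> p i - 1)"
    by (intro A.clique_bounded_partition[OF r(1) finite_verts _ _ assms(4)])
  then obtain m where m: "\<forall>v\<in>verts H. m v \<in> {1..k}"
    "\<forall>i\<in>{1..k}. \<forall>K\<subseteq>{v\<in>verts H. m v = i}. A.clique K \<longrightarrow> card K \<le> p i - 1"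
    by blast
  define V where "V i = {v\<in>verts H. m v = i}" for i
  have "clique_free (p i) (H \<restriction> V i)" if "i \<in> {1..k}" for i
  proof (rule clique_free_induce_subgraphI)
    fix S assume "S \<subseteq> V i" "\<And>u v. u \<in> S \<Longrightarrow> v \<in> S \<Longrightarrow> u \<noteq> v \<Longrightarrow> u \<rightarrow>\<^bsub>H\<^esub> v"
    then have "card S \<le> p i - 1" using m(2) that by (simp add: V_def A.clique_def)
    then show "card S < p i" using assms(6)[of i] that by auto
  qed
  moreover have "(\<Union>i\<in>{1..k}. V i) = verts H" using m(1) by (auto simp: V_def)
  moreover have "disjoint_family_on V {1..k}" by (auto simp: disjoint_family_on_def V_def)
  ultimately show ?thesis by (intro exI[of _ V] conjI ballI)
qed

end
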